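(* Consider an $\mathcal{FS}$-space in the special case $F=b\,\widetilde V(\widetilde w)$ ($b>0$; $\widetilde V$ does not depend explicitly on $x$), with $c=\mathrm{const}$. Suppose that the transformation $$t^m=\left[i^m\sin\varrho+\frac1{2\breve k}\left(1-\breve k^2+(1+\breve k^2)\cos\varrho\right)\widetilde b^m\right]\frac{H}{\sqrt\mu}F^H$$ realizes a conformal automorphism of degree $H$ of $(M,F)$ to $(M,S)$, and that $H=\mathrm{const}$. Then the coefficients $$N^m{}_i=-y^m_h\left(\frac{\partial t^h}{\partial x^i}+a^h{}_{ki}t^k\right)$$ are given explicitly by $$N^m{}_i=\frac1H\frac1{\widetilde q}\left(y^h\nabla_i\widetilde b_h\right)F\alpha^m-\frac1H\sqrt{B-H^2\widetilde q^{\,2}}\;\widetilde\beta^m_i-\left(y^h\nabla_i\widetilde b_h\right)\widetilde b^m+\widetilde b\,\nabla_i\widetilde b^m-a^m{}_{ih}y^h,$$ where $$F\alpha^m=\frac{\widetilde w}{\sqrt{\widetilde\tau-\widetilde w(\widetilde\tau'-\widetilde w)}}\left[y^m-\frac{B}{\widetilde q^{\,2}}\left(y^m-\widetilde b\,\widetilde b^m\right)\right],$$ $$\widetilde\beta^m_i=\nabla_i\widetilde b^m-\frac1{\widetilde q^{\,2}}\left(y^h\nabla_i\widetilde b_h\right)\left(y^m-\widetilde b\,\widetilde b^m\right),\qquad B=b^2\tau ,$$ and the radical $\sqrt{B-H^2\widetilde q^{\,2}}$ is taken with the sign of $b^*=\widetilde b_mt^m$.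
   Context: $(M,S)$ is a Riemannian space of dimension $N\ge3$, $S(x,y)=\sqrt{a_{ij}(x)y^iy^j}$, with Christoffel symbols $a^i{}_{kn}$ and Levi-Civita covariant derivative $\nabla_i$; $b=b_i(x)y^i$ is a non-vanishing 1-form whose Riemannian norm $c=\sqrt{a^{ij}b_ib_j}$ satisfies $0<c<1$. Put $b^i=a^{ij}b_j$, $\widetilde b_i=b_i/c$, $\widetilde b^i=b^i/c$, $\widetilde b=\widetilde b_iy^i=b/c$, $$q=\sqrt{a_{ij}y^iy^j-b^2},\quad \widetilde q=\sqrt{q^2+\left(1-\tfrac1{c^2}\right)b^2},\quad w=\frac qb,\quad\widetilde w=\frac{\widetilde q}{b},\quad i^m=\left(y^m-\tfrac1{c^2}b\,b^m\right)\frac1{\widetilde q}.$$ Everything is considered locally, in the domain $b>0$, $\widetilde q>0$. An $\mathcal{FS}$-space has a Finsler metric function depending on $x$, $b$ and $S$ only. Put $\tau=\widetilde\tau=\widetilde w\widetilde V/\widetilde V'$, prime denoting $\partial/\partial\widetilde w$ (so $\widetilde\tau'=\partial\widetilde\tau/\partial\widetilde w$). $C(x),C_1(x)$ are scalars with $C>0$, $C>|C_1|$, $$H=\sqrt{C^2-C_1^2},\qquad\breve k=\sqrt{\frac{C-C_1}{C+C_1}},\qquad\sqrt\mu=\frac{H}{2\breve k}\left[1+\breve k^2+(1-\breve k^2)\cos\varrho\right]=C+C_1\cos\varrho,$$ and $\varrho=\varrho(x,w)\in(0,\pi)$ is chosen so that $$\mu=\frac{\tau}{\widetilde w^2}\sin^2\varrho,\qquad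 \frac{\partial\varrho}{\partial\widetilde w}=\frac1{\widetilde w}\sqrt{\frac{\widetilde\tau-\widetilde w(\widetilde\tau'-\widetilde w)}{\widetilde\tau}}\,\sin\varrho$$ (the conditions used to make the transformation conformal). A Finsler metric function is smooth, positive, positively 1-homogeneous in $y$, with positive-definite $g_{ij}=\frac12\,\partial^2F^2/\partial y^i\partial y^j$. A transformation $t=t(x,y)$ (locally invertible in $y$, $x$ fixed) realizes a conformal automorphism of degree $H$ of $(M,F)$ to $(M,S)$ if $t^m(x,ky)=k^Ht^m(x,y)$ for $k>0$; $F(x,y)=1\iff S(x,t(x,y))=1$; and $g_{mn}(x,y)=p^2a_{ij}(x)t^i_mt^j_n$ with $t^i_m=\partial t^i/\partial y^m$, $p=\frac1HF^{1-H}$. The inverse is $y=y(x,t)$, and $y^m_h=\partial y^m/\partial t^h$ evaluated at $t=t(x,y)$. *)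

theory Defs
  imports "HOL-Analysis.Analysis"
begin

text \<open>
  Everything lives in a coordinate chart: points \<open>x\<close> and tangent vectors \<open>y\<close> are elements of
  \<open>real ^ 'n\<close>, and tensor fields are given by their components, with every index contraction
  written as a sum.  A field \<open>a x $ i $ j\<close> is \<open>a\<^sub>i\<^sub>j(x)\<close>, a field \<open>b x $ i\<close> is \<open>b\<^sub>i(x)\<close>.
  A \<open>t\<close> at the end of \<open>qt\<close>, \<open>wt\<close>, \<open>bt\<close> stands for the tilde.
\<close>

subsection \<open>Smoothness and partial derivatives\<close>

primrec Ck_on :: "nat \<Rightarrow> 'a::euclidean_space set \<Rightarrow> ('a \<Rightarrow> 'b::real_normed_vector) \<Rightarrow> bool" where
  "Ck_on 0 S f \<longleftrightarrow> continuous_on S f"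
| "Ck_on (Suc k) S f \<longleftrightarrow>
     f differentiable_on S \<and> (\<forall>v. Ck_on k S (\<lambda>x. frechet_derivative f (at x) v))"

text \<open>Only meant for open \<open>S\<close>.\<close>

definition smooth_on :: "'a::euclidean_space set \<Rightarrow> ('a \<Rightarrow> 'b::real_normed_vector) \<Rightarrow> bool" where
  "smooth_on S f \<longleftrightarrow> (\<forall>k. Ck_on k S f)"

definition partial_deriv :: "'n \<Rightarrow> (real ^ 'n::finite \<Rightarrow> real) \<Rightarrow> real ^ 'n \<Rightarrow> real" where
  "partial_deriv i f x = frechet_derivative f (at x) (axis i 1)"

subsection \<open>Riemannian geometry in a chart\<close>

definition riemannian_metric_on :: "(real ^ 'n::finite) set \<Rightarrow> (real ^ 'n \<Rightarrow> real ^ 'n ^ 'n) \<Rightarrow> bool"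
  where "riemannian_metric_on U a \<longleftrightarrow> open U \<and> smooth_on U a \<and>
    (\<forall>x\<in>U. (\<forall>i j. a x $ i $ j = a x $ j $ i) \<and>
            (\<forall>v. v \<noteq> 0 \<longrightarrow> (\<Sum>i\<in>UNIV. \<Sum>j\<in>UNIV. a x $ i $ j * v $ i * v $ j) > 0))"

definition riem_S :: "(real ^ 'n::finite \<Rightarrow> real ^ 'n ^ 'n) \<Rightarrow> real ^ 'n \<Rightarrow> real ^ 'n \<Rightarrow> real" where
  "riem_S a x y = sqrt (\<Sum>i\<in>UNIV. \<Sum>j\<in>UNIV. a x $ i $ j * y $ i * y $ j)"

text \<open>\<open>christoffel a x i k n\<close> is \<open>a\<^sup>i\<^sub>k\<^sub>n(x)\<close>, the first index being the upper one.\<close>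

definition christoffel ::
  "(real ^ 'n::finite \<Rightarrow> real ^ 'n ^ 'n) \<Rightarrow> real ^ 'n \<Rightarrow> 'n \<Rightarrow> 'n \<Rightarrow> 'n \<Rightarrow> real" where
  "christoffel a x i k n = (1/2) * (\<Sum>j\<in>UNIV. matrix_inv (a x) $ i $ j *
     (partial_deriv k (\<lambda>z. a z $ j $ n) x + partial_deriv n (\<lambda>z. a z $ j $ k) x
       - partial_deriv j (\<lambda>z. a z $ k $ n) x))"

definition nabla_covec ::
  "(real ^ 'n::finite \<Rightarrow> real ^ 'n ^ 'n) \<Rightarrow> (real ^ 'n \<Rightarrow> real ^ 'n) \<Rightarrow> real ^ 'n \<Rightarrow> 'n \<Rightarrow> 'n \<Rightarrow> real"
  where "nabla_covec a \<omega> x i h =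
    partial_deriv i (\<lambda>z. \<omega> z $ h) x - (\<Sum>k\<in>UNIV. christoffel a x k h i * \<omega> x $ k)"

definition nabla_vec ::
  "(real ^ 'n::finite \<Rightarrow> real ^ 'n ^ 'n) \<Rightarrow> (real ^ 'n \<Rightarrow> real ^ 'n) \<Rightarrow> real ^ 'n \<Rightarrow> 'n \<Rightarrow> 'n \<Rightarrow> real"
  where "nabla_vec a X x i m =
    partial_deriv i (\<lambda>z. X z $ m) x + (\<Sum>k\<in>UNIV. christoffel a x m k i * X x $ k)"

subsection \<open>The 1-form and the variables derived from it\<close>

definition b_form :: "(real ^ 'n::finite \<Rightarrow> real ^ 'n) \<Rightarrow> real ^ 'n \<Rightarrow> real ^ 'n \<Rightarrow> real" where
  "b_form b x y = (\<Sum>i\<in>UNIV. b x $ i * y $ i)"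

definition c_norm ::
  "(real ^ 'n::finite \<Rightarrow> real ^ 'n ^ 'n) \<Rightarrow> (real ^ 'n \<Rightarrow> real ^ 'n) \<Rightarrow> real ^ 'n \<Rightarrow> real" where
  "c_norm a b x = sqrt (\<Sum>i\<in>UNIV. \<Sum>j\<in>UNIV. matrix_inv (a x) $ i $ j * b x $ i * b x $ j)"

definition b_up ::
  "(real ^ 'n::finite \<Rightarrow> real ^ 'n ^ 'n) \<Rightarrow> (real ^ 'n \<Rightarrow> real ^ 'n) \<Rightarrow> real ^ 'n \<Rightarrow> real ^ 'n" where
  "b_up a b x = (\<chi> i. \<Sum>j\<in>UNIV. matrix_inv (a x) $ i $ j * b x $ j)"

definition bt_low ::
  "(real ^ 'n::finite \<Rightarrow> real ^ 'n ^ 'n) \<Rightarrow> (real ^ 'n \<Rightarrow> real ^ 'n) \<Rightarrow> real ^ 'n \<Rightarrow> real ^ 'n" where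
  "bt_low a b x = (\<chi> i. b x $ i / c_norm a b x)"

definition bt_up ::
  "(real ^ 'n::finite \<Rightarrow> real ^ 'n ^ 'n) \<Rightarrow> (real ^ 'n \<Rightarrow> real ^ 'n) \<Rightarrow> real ^ 'n \<Rightarrow> real ^ 'n" where
  "bt_up a b x = (\<chi> i. b_up a b x $ i / c_norm a b x)"

definition bt_form ::
  "(real ^ 'n::finite \<Rightarrow> real ^ 'n ^ 'n) \<Rightarrow> (real ^ 'n \<Rightarrow> real ^ 'n) \<Rightarrow> real ^ 'n \<Rightarrow> real ^ 'n \<Rightarrow> real"
  where "bt_form a b x y = (\<Sum>i\<in>UNIV. bt_low a b x $ i * y $ i)"

definition q_fun ::
  "(real ^ 'n::finite \<Rightarrow> real ^ 'n ^ 'n) \<Rightarrow> (real ^ 'n \<Rightarrow> real ^ 'n) \<Rightarrow> real ^ 'n \<Rightarrow> real ^ 'n \<Rightarrow> real"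
  where "q_fun a b x y =
    sqrt ((\<Sum>i\<in>UNIV. \<Sum>j\<in>UNIV. a x $ i $ j * y $ i * y $ j) - (b_form b x y)\<^sup>2)"

definition qt_fun ::
  "(real ^ 'n::finite \<Rightarrow> real ^ 'n ^ 'n) \<Rightarrow> (real ^ 'n \<Rightarrow> real ^ 'n) \<Rightarrow> real ^ 'n \<Rightarrow> real ^ 'n \<Rightarrow> real"
  where "qt_fun a b x y =
    sqrt ((q_fun a b x y)\<^sup>2 + (1 - 1 / (c_norm a b x)\<^sup>2) * (b_form b x y)\<^sup>2)"

definition w_fun ::
  "(real ^ 'n::finite \<Rightarrow> real ^ 'n ^ 'n) \<Rightarrow> (real ^ 'n \<Rightarrow> real ^ 'n) \<Rightarrow> real ^ 'n \<Rightarrow> real ^ 'n \<Rightarrow> real"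
  where "w_fun a b x y = q_fun a b x y / b_form b x y"

definition wt_fun ::
  "(real ^ 'n::finite \<Rightarrow> real ^ 'n ^ 'n) \<Rightarrow> (real ^ 'n \<Rightarrow> real ^ 'n) \<Rightarrow> real ^ 'n \<Rightarrow> real ^ 'n \<Rightarrow> real"
  where "wt_fun a b x y = qt_fun a b x y / b_form b x y"

text \<open>
  By definition \<open>wt\<^sup>2 = w\<^sup>2 + 1 - 1/c\<^sup>2\<close>; this is \<open>w\<close> as a function of \<open>x\<close> and \<open>wt\<close>, through which
  functions of \<open>(x, w)\<close> are differentiated with respect to \<open>wt\<close>.
\<close>

definition w_of_wt ::
  "(real ^ 'n::finite \<Rightarrow> real ^ 'n ^ 'n) \<Rightarrow> (real ^ 'n \<Rightarrow> real ^ 'n) \<Rightarrow> real ^ 'n \<Rightarrow> real \<Rightarrow> real"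
  where "w_of_wt a b x s = sqrt (s\<^sup>2 - (1 - 1 / (c_norm a b x)\<^sup>2))"

definition i_vec ::
  "(real ^ 'n::finite \<Rightarrow> real ^ 'n ^ 'n) \<Rightarrow> (real ^ 'n \<Rightarrow> real ^ 'n) \<Rightarrow> real ^ 'n \<Rightarrow> real ^ 'n \<Rightarrow> real ^ 'n"
  where "i_vec a b x y =
    (\<chi> m. (y $ m - 1 / (c_norm a b x)\<^sup>2 * b_form b x y * b_up a b x $ m) * (1 / qt_fun a b x y))"

subsection \<open>Finsler metric functions\<close>

text \<open>
  The domain \<open>D\<close> of pairs \<open>(x, y)\<close> is an arbitrary open set over the chart domain \<open>U\<close> that is conic
  in \<open>y\<close>, because the considerations are local.
\<close>

definition conic_domain :: "(real ^ 'n::finite) set \<Rightarrow> ((real ^ 'n) \<times> (real ^ 'n)) set \<Rightarrow> bool" where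
  "conic_domain U D \<longleftrightarrow> open D \<and> D \<subseteq> U \<times> UNIV \<and> (\<forall>(x, y)\<in>D. \<forall>k>0. (x, k *\<^sub>R y) \<in> D)"

definition finsler_tensor ::
  "(real ^ 'n::finite \<Rightarrow> real ^ 'n \<Rightarrow> real) \<Rightarrow> real ^ 'n \<Rightarrow> real ^ 'n \<Rightarrow> 'n \<Rightarrow> 'n \<Rightarrow> real" where
  "finsler_tensor F x y i j =
     (1/2) * partial_deriv i (\<lambda>z. partial_deriv j (\<lambda>v. (F x v)\<^sup>2) z) y"

definition finsler_metric_on ::
  "((real ^ 'n::finite) \<times> (real ^ 'n)) set \<Rightarrow> (real ^ 'n \<Rightarrow> real ^ 'n \<Rightarrow> real) \<Rightarrow> bool" where
  "finsler_metric_on D F \<longleftrightarrow> smooth_on D (\<lambda>(x, y). F x y) \<and>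
    (\<forall>(x, y)\<in>D. F x y > 0 \<and> (\<forall>k>0. F x (k *\<^sub>R y) = k * F x y) \<and>
      (\<forall>v. v \<noteq> 0 \<longrightarrow>
         (\<Sum>i\<in>UNIV. \<Sum>j\<in>UNIV. finsler_tensor F x y i j * v $ i * v $ j) > 0))"

definition FS_space ::
  "((real ^ 'n::finite) \<times> (real ^ 'n)) set \<Rightarrow> (real ^ 'n \<Rightarrow> real ^ 'n ^ 'n) \<Rightarrow> (real ^ 'n \<Rightarrow> real ^ 'n) \<Rightarrow>
    (real ^ 'n \<Rightarrow> real ^ 'n \<Rightarrow> real) \<Rightarrow> bool" where
  "FS_space D a b F \<longleftrightarrow> finsler_metric_on D F \<and>
    (\<exists>\<Phi>. \<forall>(x, y)\<in>D. F x y = \<Phi> x (b_form b x y) (riem_S a x y))"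

subsection \<open>Conformal automorphisms\<close>

definition local_inverse_at :: "('a::topological_space \<Rightarrow> 'b::topological_space) \<Rightarrow> ('b \<Rightarrow> 'a) \<Rightarrow> 'a \<Rightarrow> bool"
  where "local_inverse_at f g y \<longleftrightarrow>
    (\<exists>E. open E \<and> y \<in> E \<and> open (f ` E) \<and> homeomorphism E (f ` E) f g)"

text \<open>\<open>t x y $ i\<close> is \<open>t\<^sup>i(x, y)\<close>; the degree \<open>H\<close> is a scalar field that may a priori depend on \<open>x\<close>.\<close>

definition conformal_automorphism ::
  "((real ^ 'n::finite) \<times> (real ^ 'n)) set \<Rightarrow> (real ^ 'n \<Rightarrow> real ^ 'n ^ 'n) \<Rightarrow>
    (real ^ 'n \<Rightarrow> real ^ 'n \<Rightarrow> real) \<Rightarrow> (real ^ 'n \<Rightarrow> real) \<Rightarrow>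
    (real ^ 'n \<Rightarrow> real ^ 'n \<Rightarrow> real ^ 'n) \<Rightarrow> bool" where
  "conformal_automorphism D a F H t \<longleftrightarrow> smooth_on D (\<lambda>(x, y). t x y) \<and>
    (\<forall>(x, y)\<in>D.
      (\<exists>g. local_inverse_at (t x) g y) \<and>
      (\<forall>k>0. t x (k *\<^sub>R y) = (k powr H x) *\<^sub>R t x y) \<and>
      (F x y = 1 \<longleftrightarrow> riem_S a x (t x y) = 1) \<and>
      (\<forall>m n. finsler_tensor F x y m n =
        (1 / H x * F x y powr (1 - H x))\<^sup>2 *
        (\<Sum>i\<in>UNIV. \<Sum>j\<in>UNIV. a x $ i $ j *
           partial_deriv m (\<lambda>z. t x z $ i) y * partial_deriv n (\<lambda>z. t x z $ j) y)))"

text \<open>The coefficients \<open>N\<^sup>m\<^sub>i\<close>; \<open>Y x\<close> is the inverse \<open>t \<mapsto> y(x, t)\<close> of \<open>y \<mapsto> t(x, y)\<close>.\<close>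

definition N_coeff ::
  "(real ^ 'n::finite \<Rightarrow> real ^ 'n ^ 'n) \<Rightarrow> (real ^ 'n \<Rightarrow> real ^ 'n \<Rightarrow> real ^ 'n) \<Rightarrow>
    (real ^ 'n \<Rightarrow> real ^ 'n \<Rightarrow> real ^ 'n) \<Rightarrow> real ^ 'n \<Rightarrow> real ^ 'n \<Rightarrow> 'n \<Rightarrow> 'n \<Rightarrow> real" where
  "N_coeff a t Y x y m i =
    - (\<Sum>h\<in>UNIV. partial_deriv h (\<lambda>u. Y x u $ m) (t x y) *
        (partial_deriv i (\<lambda>z. t z y $ h) x + (\<Sum>k\<in>UNIV. christoffel a x h k i * t x y $ k)))"

subsection \<open>The scalars entering the transformation\<close>

definition H_deg :: "('p \<Rightarrow> real) \<Rightarrow> ('p \<Rightarrow> real) \<Rightarrow> 'p \<Rightarrow> real" where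
  "H_deg C C1 x = sqrt ((C x)\<^sup>2 - (C1 x)\<^sup>2)"

definition k_breve :: "('p \<Rightarrow> real) \<Rightarrow> ('p \<Rightarrow> real) \<Rightarrow> 'p \<Rightarrow> real" where
  "k_breve C C1 x = sqrt ((C x - C1 x) / (C x + C1 x))"

text \<open>
  \<open>\<mu>\<close> as a function of \<open>x\<close> and the angle \<open>r\<close>.  The squared expression is positive and equals
  \<open>C + C1 cos r\<close>, so it is \<open>sqrt \<mu>\<close>; see \<open>sqrt_mu_fun\<close>.
\<close>

definition mu_fun :: "('p \<Rightarrow> real) \<Rightarrow> ('p \<Rightarrow> real) \<Rightarrow> 'p \<Rightarrow> real \<Rightarrow> real" where
  "mu_fun C C1 x r = (H_deg C C1 x / (2 * k_breve C C1 x) *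
     (1 + (k_breve C C1 x)\<^sup>2 + (1 - (k_breve C C1 x)\<^sup>2) * cos r))\<^sup>2"

lemma sqrt_mu_fun:
  assumes "C x > \<bar>C1 x\<bar>"
  shows "sqrt (mu_fun C C1 x r) = H_deg C C1 x / (2 * k_breve C C1 x) *
           (1 + (k_breve C C1 x)\<^sup>2 + (1 - (k_breve C C1 x)\<^sup>2) * cos r)"
    and "sqrt (mu_fun C C1 x r) = C x + C1 x * cos r"
proof -
  have p: "C x + C1 x > 0" "C x - C1 x > 0" using assms by auto
  have k2: "(k_breve C C1 x)\<^sup>2 = (C x - C1 x) / (C x + C1 x)"
    using p by (simp add: k_breve_def)
  have "H_deg C C1 x = sqrt ((C x - C1 x) / (C x + C1 x) * (C x + C1 x)\<^sup>2)"
    unfolding H_deg_def using p by (simp add: power2_eq_square field_simps)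
  also have "\<dots> = k_breve C C1 x * (C x + C1 x)"
    using p unfolding real_sqrt_mult k_breve_def by simp
  finally have H: "H_deg C C1 x = k_breve C C1 x * (C x + C1 x)" .
  have "k_breve C C1 x > 0" using p by (simp add: k_breve_def)
  then have h: "H_deg C C1 x / (2 * k_breve C C1 x) = (C x + C1 x) / 2"
    unfolding H by simp
  have "s / 2 * (1 + d / s + (1 - d / s) * z) = (s + d + (s - d) * z) / 2"
    if "s \<noteq> 0" for s d z :: real
    using that by (simp add: field_simps)
  from this[of "C x + C1 x" "C x - C1 x" "cos r"] p
  have e: "H_deg C C1 x / (2 * k_breve C C1 x) *
      (1 + (k_breve C C1 x)\<^sup>2 + (1 - (k_breve C C1 x)\<^sup>2) * cos r) = C x + C1 x * cos r"
    unfolding h k2 by simp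
  have "\<bar>C1 x * cos r\<bar> \<le> \<bar>C1 x\<bar>"
    unfolding abs_mult by (rule mult_left_le) auto
  then have "C x + C1 x * cos r \<ge> 0" using assms by linarith
  then show "sqrt (mu_fun C C1 x r) = C x + C1 x * cos r"
    unfolding mu_fun_def e by simp
  with e show "sqrt (mu_fun C C1 x r) = H_deg C C1 x / (2 * k_breve C C1 x) *
      (1 + (k_breve C C1 x)\<^sup>2 + (1 - (k_breve C C1 x)\<^sup>2) * cos r)"
    by simp
qed

definition tau_fun :: "(real \<Rightarrow> real) \<Rightarrow> real \<Rightarrow> real" where
  "tau_fun V s = s * V s / deriv V s"

definition rad_tau :: "(real \<Rightarrow> real) \<Rightarrow> real \<Rightarrow> real" where
  "rad_tau V s = tau_fun V s - s * (deriv (tau_fun V) s - s)"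

subsection \<open>The ingredients of the explicit formula\<close>

definition B_fun ::
  "(real ^ 'n::finite \<Rightarrow> real ^ 'n ^ 'n) \<Rightarrow> (real ^ 'n \<Rightarrow> real ^ 'n) \<Rightarrow> (real \<Rightarrow> real) \<Rightarrow>
    real ^ 'n \<Rightarrow> real ^ 'n \<Rightarrow> real" where
  "B_fun a b V x y = (b_form b x y)\<^sup>2 * tau_fun V (wt_fun a b x y)"

text \<open>\<open>y\<^sup>h \<nabla>\<^sub>i bt\<^sub>h\<close>\<close>

definition y_nabla_bt ::
  "(real ^ 'n::finite \<Rightarrow> real ^ 'n ^ 'n) \<Rightarrow> (real ^ 'n \<Rightarrow> real ^ 'n) \<Rightarrow>
    real ^ 'n \<Rightarrow> real ^ 'n \<Rightarrow> 'n \<Rightarrow> real" where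
  "y_nabla_bt a b x y i = (\<Sum>h\<in>UNIV. y $ h * nabla_covec a (bt_low a b) x i h)"

text \<open>The vector \<open>F \<alpha>\<^sup>m\<close> as a whole; \<open>F\<close> is not an argument.\<close>

definition F_alpha ::
  "(real ^ 'n::finite \<Rightarrow> real ^ 'n ^ 'n) \<Rightarrow> (real ^ 'n \<Rightarrow> real ^ 'n) \<Rightarrow> (real \<Rightarrow> real) \<Rightarrow>
    real ^ 'n \<Rightarrow> real ^ 'n \<Rightarrow> 'n \<Rightarrow> real" where
  "F_alpha a b V x y m = wt_fun a b x y / sqrt (rad_tau V (wt_fun a b x y)) *
     (y $ m - B_fun a b V x y / (qt_fun a b x y)\<^sup>2 * (y $ m - bt_form a b x y * bt_up a b x $ m))"

definition beta_t ::
  "(real ^ 'n::finite \<Rightarrow> real ^ 'n ^ 'n) \<Rightarrow> (real ^ 'n \<Rightarrow> real ^ 'n) \<Rightarrow>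
    real ^ 'n \<Rightarrow> real ^ 'n \<Rightarrow> 'n \<Rightarrow> 'n \<Rightarrow> real" where
  "beta_t a b x y m i = nabla_vec a (bt_up a b) x i m -
     1 / (qt_fun a b x y)\<^sup>2 * y_nabla_bt a b x y i * (y $ m - bt_form a b x y * bt_up a b x $ m)"

end

(*
Write y = bt E + qt I, where E = bt^m is a unit field and I = i^m is the unit vector orthogonal to it.
Then t = F^H (sg I + kp E) with sg^2 + kp^2 = 1, and the condition on mu gives sg = H wt / sqrt tau.
Hence, for constant H, t depends on x only through the metric and E, up to the sign of kp, which is
locally constant along paths with fixed wt.  Let G be the matrix of Christoffel symbols a^m_{ki} for fixed i,
nu = nabla_i E, eta = y^h nabla_i bt_h, and let A be the infinitesimal rotation A v = bt(v) nu - <nu,v> E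
that moves E covariantly.  Moving x in the direction i and y with velocity A y - G y moves the whole frame
rigidly, so t moves with velocity A t - G t.  Therefore N = A y - G y - J^-1 (A t), with J the
Jacobian of t in y, and J is determined on the part of nu orthogonal to E and I (rotations about E), on y
(homogeneity) and on I (the differential equation for rho).
*)

theory Submission
  imports Defs
begin

section \<open>Matrices and derivatives along paths\<close>

text \<open>Differentiating the given formula for t in x would bring in the x-derivatives of C, C1
  and rho, of which constant H controls only the combination C^2 - C1^2. They are avoided by holding
  the invariants \<open>bt\<close> and \<open>qt\<close> fixed while x moves: since c is constant,
  \<open>b\<close>, \<open>wt\<close>, F and \<open>sg\<close> are then fixed too, and only the sign
  of \<open>kp\<close> is left to control. It is settled by continuity of t, because
  \<open>kp\<close> is the E-component of t divided by F^H. The same sign is that of b^* and is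
  carried by the radical, as B - H^2 qt^2 = b^2 tau kp^2. The matrix J^-1 is never computed: the
  claimed N is fed into J. Three facts that this needs are extracted from the hypotheses: V is
  differentiable because F is smooth, J is injective because the Finsler tensor is positive
  definite, and the radicand in the equation for rho is nonzero because otherwise J would send y and
  I to parallel vectors.\<close>

lemma quadratic_sum_eq_inner:
  fixes A :: "real ^ 'n::finite ^ 'n" and u v :: "real ^ 'n"
  shows "(\<Sum>i\<in>UNIV. \<Sum>j\<in>UNIV. A $ i $ j * u $ i * v $ j) = u \<bullet> (A *v v)"
  by (simp add: inner_vec_def matrix_vector_mult_def sum_distrib_left algebra_simps)

lemma matrix_inv_mult:
  fixes A :: "real ^ 'n::finite ^ 'n"
  assumes "invertible A"
  shows "A ** matrix_inv A = mat 1" "matrix_inv A ** A = mat 1"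
  using someI_ex[OF assms[unfolded invertible_def]] by (auto simp: matrix_inv_def)

lemma bounded_bilinear_matrix_vector_mult:
  "bounded_bilinear (\<lambda>(A :: real ^ 'n::finite ^ 'm::finite) v. A *v v)"
proof (rule bilinear_conv_bounded_bilinear[THEN iffD1], unfold bilinear_def, intro conjI allI)
  show "linear ((*v) A)" for A :: "real ^ 'n ^ 'm"
    by (rule matrix_vector_mul_linear)
  show "linear (\<lambda>A :: real ^ 'n ^ 'm. A *v v)" for v
    by (rule linearI)
      (simp_all add: matrix_vector_mult_add_rdistrib scaleR_matrix_vector_assoc)
qed

lemmas has_vector_derivative_matrix_vector_mult =
  bounded_bilinear.has_vector_derivative[OF bounded_bilinear_matrix_vector_mult]

lemma has_vector_derivative_inner:
  fixes f g :: "real \<Rightarrow> 'a::real_inner"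
  assumes "(f has_vector_derivative f') (at x within S)" "(g has_vector_derivative g') (at x within S)"
  shows "((\<lambda>s. f s \<bullet> g s) has_real_derivative (f x \<bullet> g' + f' \<bullet> g x)) (at x within S)"
  using bounded_bilinear.has_vector_derivative[OF bounded_bilinear_inner assms]
  by (simp add: has_real_derivative_iff_has_vector_derivative)

section \<open>Differentiability of vectors, determinants and inverse matrices\<close>

lemma differentiable_vec_componentwise:
  fixes f :: "'a::real_normed_vector \<Rightarrow> 'b::euclidean_space ^ 'n::finite"
  assumes "\<And>i. (\<lambda>x. f x $ i) differentiable (at x)"
  shows "f differentiable (at x)"
proof (subst differentiable_componentwise_within, rule ballI)
  fix j :: "'b ^ 'n" assume "j \<in> Basis"
  then obtain i u where j: "j = axis i u" "u \<in> Basis"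
    unfolding Basis_vec_def by auto
  have "(\<lambda>x. f x $ i \<bullet> u) differentiable (at x)"
    using assms[of i] by (simp add: differentiable_componentwise_within[of "\<lambda>x. f x $ i"] j)
  then show "(\<lambda>x. f x \<bullet> j) differentiable (at x)"
    by (simp add: j inner_axis)
qed

lemma differentiable_vec_nth:
  assumes "f differentiable F"
  shows "(\<lambda>x. f x $ i) differentiable F"
  using assms bounded_linear.has_derivative[OF bounded_linear_vec_nth]
  unfolding differentiable_def by blast

lemma differentiable_prod:
  fixes f :: "'i \<Rightarrow> 'a::real_normed_vector \<Rightarrow> real"
  assumes "\<And>i. i \<in> I \<Longrightarrow> f i differentiable (at x)"
  shows "(\<lambda>x. \<Prod>i\<in>I. f i x) differentiable (at x)"
proof -
  have "(f i has_derivative frechet_derivative (f i) (at x)) (at x)" if "i \<in> I" for i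
    using assms[OF that] by (simp add: frechet_derivative_works)
  from has_derivative_prod[of I f, OF this] show ?thesis
    by (rule differentiableI)
qed

lemma differentiable_det:
  fixes A :: "'a::real_normed_vector \<Rightarrow> real ^ 'n::finite ^ 'n"
  assumes "\<And>i j. (\<lambda>x. A x $ i $ j) differentiable (at x)"
  shows "(\<lambda>x. det (A x)) differentiable (at x)"
  unfolding det_def
  by (intro differentiable_sum ballI differentiable_mult differentiable_const differentiable_prod assms)
    (simp add: finite_permutations)

text \<open>By Cramer's rule each component is a quotient of two determinants, hence differentiable.
  Invertibility on an open set makes the quotient agree with the component near \<open>x\<close>, so
  that the derivative transfers. Needed because the field E is defined through the inverse of
  \<open>a\<close>.\<close>

lemma differentiable_matrix_inv_mult:
  fixes A :: "'a::real_normed_vector \<Rightarrow> real ^ 'n::finite ^ 'n"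
  assumes A: "A differentiable (at x)" and v: "v differentiable (at x)"
    and S: "open S" "x \<in> S" and inv: "\<And>z. z \<in> S \<Longrightarrow> invertible (A z)"
  shows "(\<lambda>z. matrix_inv (A z) *v v z) differentiable (at x)"
proof (rule differentiable_vec_componentwise)
  fix k
  have det: "det (A z) \<noteq> 0" if "z \<in> S" for z
    using inv[OF that] by (simp add: invertible_det_nz)
  have eq: "det (\<chi> i j. if j = k then v z $ i else A z $ i $ j) / det (A z) = (matrix_inv (A z) *v v z) $ k"
    if "z \<in> S" for z
  proof -
    have "A z *v (matrix_inv (A z) *v v z) = v z"
      by (simp add: matrix_vector_mul_assoc matrix_inv_mult inv that)
    from this[unfolded cramer[OF det[OF that]]] show ?thesis
      by (metis (no_types, lifting) vec_lambda_beta)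
  qed
  have "(\<lambda>z. det (\<chi> i j. if j = k then v z $ i else A z $ i $ j) / det (A z)) differentiable (at x)"
  proof (intro differentiable_divide differentiable_det det S)
    show "(\<lambda>z. (\<chi> i j. if j = k then v z $ i else A z $ i $ j) $ i $ j) differentiable (at x)" for i j
      by (cases "j = k") (auto intro!: differentiable_vec_nth A v)
  qed (intro differentiable_vec_nth A)
  then obtain D where
    "((\<lambda>z. det (\<chi> i j. if j = k then v z $ i else A z $ i $ j) / det (A z)) has_derivative D) (at x)"
    unfolding differentiable_def by blast
  then have "((\<lambda>z. (matrix_inv (A z) *v v z) $ k) has_derivative D) (at x)"
    by (rule has_derivative_transform_within_open) (use S eq in auto)
  then show "(\<lambda>z. (matrix_inv (A z) *v v z) $ k) differentiable (at x)"
    by (rule differentiableI)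
qed

lemma smooth_on_differentiable:
  assumes "smooth_on S f" "open S" "x \<in> S"
  shows "f differentiable (at x)"
proof -
  have "Ck_on (Suc 0) S f" using assms(1) unfolding smooth_on_def by blast
  then show ?thesis using assms(2,3) by (simp add: differentiable_on_eq_differentiable_at)
qed

section \<open>Derivatives along paths\<close>

lemma partial_deriv_eq:
  "(f has_derivative f') (at x) \<Longrightarrow> partial_deriv k f x = f' (axis k 1)"
  unfolding partial_deriv_def by (metis frechet_derivative_at)

lemma has_vector_derivative_comp_path:
  assumes "(f has_derivative f') (at (p s))" "(p has_vector_derivative e) (at s)"
  shows "((\<lambda>s. f (p s)) has_vector_derivative f' e) (at s)"
proof -
  have "((\<lambda>s. f (p s)) has_derivative (\<lambda>r. f' (r *\<^sub>R e))) (at s)"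
    using has_derivative_compose[of p "\<lambda>r. r *\<^sub>R e" s UNIV f f'] assms
    by (simp add: has_vector_derivative_def)
  moreover have "f' (r *\<^sub>R e) = r *\<^sub>R f' e" for r
    using assms(1) by (meson has_derivative_linear linear_scale)
  ultimately show ?thesis by (simp add: has_vector_derivative_def)
qed

lemmas has_vector_derivative_scaleR_right =
  bounded_linear.has_vector_derivative[OF bounded_linear_scaleR_right]

lemma has_vector_derivative_transform_eventually:
  assumes "(f has_vector_derivative f') (at x)" "\<forall>\<^sub>F y in nhds x. f y = g y"
  shows "(g has_vector_derivative f') (at x)"
  using assms(2) has_vector_derivative_transform_within_open[OF assms(1)]
  unfolding eventually_nhds by blast

lemma isCont_tendsto_nhds: "isCont f x \<Longrightarrow> (f \<longlongrightarrow> f x) (nhds x)"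
  by (simp add: isCont_def tendsto_at_iff_tendsto_nhds)

lemma line_derivative: "((\<lambda>s. x + s *\<^sub>R e) has_vector_derivative e) (at 0)"
  by (auto intro!: derivative_eq_intros)

lemma linear_nth_sum:
  fixes f :: "real ^ 'm::finite \<Rightarrow> real ^ 'k"
  assumes "linear f"
  shows "f v $ j = (\<Sum>h\<in>UNIV. f (axis h 1) $ j * v $ h)"
proof -
  have "f v = matrix f *v v" using assms by (simp add: matrix_works)
  then show ?thesis by (simp add: matrix_vector_mult_def matrix_def)
qed

section \<open>Metric compatibility in a chart\<close>

text \<open>With the direction \<open>i\<close> frozen the connection acts on components as one
  matrix G, so that the covariant derivative of a field X in that direction is its partial
  derivative plus G X.\<close>

definition christoffel_mat ::
  "(real ^ 'n::finite \<Rightarrow> real ^ 'n ^ 'n) \<Rightarrow> real ^ 'n \<Rightarrow> 'n \<Rightarrow> real ^ 'n ^ 'n" where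
  "christoffel_mat a x i = (\<chi> m k. christoffel a x m k i)"

locale riemannian_chart =
  fixes U :: "(real ^ 'n::finite) set" and a :: "real ^ 'n \<Rightarrow> real ^ 'n ^ 'n"
  assumes metric: "riemannian_metric_on U a"
begin

lemma open_U: "open U"
  using metric by (simp add: riemannian_metric_on_def)

lemma a_differentiable: "x \<in> U \<Longrightarrow> a differentiable (at x)"
  using metric smooth_on_differentiable by (auto simp: riemannian_metric_on_def)

lemma a_has_derivative: "x \<in> U \<Longrightarrow> (a has_derivative frechet_derivative a (at x)) (at x)"
  using a_differentiable by (simp add: frechet_derivative_works[symmetric])

lemma a_sym: "x \<in> U \<Longrightarrow> a x $ i $ j = a x $ j $ i"
  using metric unfolding riemannian_metric_on_def by blast

lemma a_inner_commute: "x \<in> U \<Longrightarrow> u \<bullet> (a x *v v) = v \<bullet> (a x *v u)"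
  using a_sym[of x] by (simp add: inner_vec_def matrix_vector_mult_def sum_distrib_left)
    (subst sum.swap, auto intro!: sum.cong simp: mult_ac)

lemma a_pos: "x \<in> U \<Longrightarrow> v \<noteq> 0 \<Longrightarrow> v \<bullet> (a x *v v) > 0"
  using metric unfolding riemannian_metric_on_def quadratic_sum_eq_inner by blast

lemma a_nonneg: "x \<in> U \<Longrightarrow> v \<bullet> (a x *v v) \<ge> 0"
  using a_pos[of x v] by (cases "v = 0") auto

lemma a_invertible: "x \<in> U \<Longrightarrow> invertible (a x)"
proof -
  assume "x \<in> U"
  then have "v = 0" if "a x *v v = 0" for v
    using a_pos[of x v] that by auto
  then show ?thesis
    unfolding invertible_left_inverse matrix_left_invertible_ker by blast
qed

lemma partial_deriv_a:
  "x \<in> U \<Longrightarrow> partial_deriv k (\<lambda>z. a z $ j $ n) x = frechet_derivative a (at x) (axis k 1) $ j $ n"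
  by (rule partial_deriv_eq)
    (intro bounded_linear.has_derivative[OF bounded_linear_vec_nth] a_has_derivative)

lemma partial_deriv_a_sym:
  assumes "x \<in> U"
  shows "partial_deriv k (\<lambda>z. a z $ j $ n) x = partial_deriv k (\<lambda>z. a z $ n $ j) x"
proof -
  have "((\<lambda>z. a z $ n $ j) has_derivative (\<lambda>v. frechet_derivative a (at x) v $ n $ j)) (at x)"
    by (intro bounded_linear.has_derivative[OF bounded_linear_vec_nth] a_has_derivative assms)
  then have "((\<lambda>z. a z $ j $ n) has_derivative (\<lambda>v. frechet_derivative a (at x) v $ n $ j)) (at x)"
    by (rule has_derivative_transform_within_open[OF _ open_U assms]) (rule a_sym)
  from partial_deriv_eq[OF this] show ?thesis
    by (simp add: partial_deriv_a[OF assms])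
qed

lemma christoffel_sym: "x \<in> U \<Longrightarrow> christoffel a x m k n = christoffel a x m n k"
  unfolding christoffel_def using partial_deriv_a_sym[of x _ k n] by (simp add: add.commute)

text \<open>The right-hand side is the Christoffel symbol of the first kind: multiplying by
  \<open>a x\<close> cancels the inverse matrix in the definition of
  \<open>christoffel\<close>.\<close>

lemma a_christoffel:
  assumes "x \<in> U"
  shows "(a x ** christoffel_mat a x i) $ j $ k = (1/2) *
    (partial_deriv k (\<lambda>z. a z $ j $ i) x + partial_deriv i (\<lambda>z. a z $ j $ k) x
      - partial_deriv j (\<lambda>z. a z $ k $ i) x)"
proof -
  define T where "T = (\<chi> j k. (1/2) * (partial_deriv k (\<lambda>z. a z $ j $ i) x
    + partial_deriv i (\<lambda>z. a z $ j $ k) x - partial_deriv j (\<lambda>z. a z $ k $ i) x))"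
  have "christoffel_mat a x i = matrix_inv (a x) ** T"
    by (simp add: vec_eq_iff christoffel_mat_def christoffel_def matrix_matrix_mult_def T_def
        sum_divide_distrib)
  then have "a x ** christoffel_mat a x i = T"
    by (simp add: matrix_mul_assoc matrix_inv_mult a_invertible assms)
  then show ?thesis by (simp add: T_def)
qed

text \<open>This is nabla a = 0. In the first-kind symbol two of the three terms are antisymmetric
  in j, k, so adding the transpose leaves the derivative of a_jk alone. It removes the derivative of
  \<open>a\<close> whenever an inner product is differentiated in x.\<close>

lemma metric_compatible:
  assumes "x \<in> U"
  shows "u \<bullet> (frechet_derivative a (at x) (axis i 1) *v v) =
    u \<bullet> (a x *v (christoffel_mat a x i *v v)) + v \<bullet> (a x *v (christoffel_mat a x i *v u))"
proof -
  let ?M = "a x ** christoffel_mat a x i"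
  have "frechet_derivative a (at x) (axis i 1) $ j $ k = ?M $ j $ k + ?M $ k $ j" for j k
    unfolding a_christoffel[OF assms] partial_deriv_a[OF assms, symmetric]
    using partial_deriv_a_sym[OF assms, of i j k] partial_deriv_a_sym[OF assms, of j k i]
      partial_deriv_a_sym[OF assms, of k j i]
    by (simp add: field_simps)
  then have "frechet_derivative a (at x) (axis i 1) = ?M + transpose ?M"
    by (simp add: vec_eq_iff transpose_def)
  moreover have "u \<bullet> (transpose ?M *v v) = v \<bullet> (?M *v u)"
    by (simp only: transpose_matrix_vector dot_lmul_matrix inner_commute[of u])
  ultimately show ?thesis
    by (simp add: matrix_vector_mult_add_rdistrib inner_add_right matrix_vector_mul_assoc
        del: transpose_matrix_vector)
qed

lemma nabla_vec_eq:
  assumes "(X has_derivative X') (at x)"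
  shows "nabla_vec a X x i m = (X' (axis i 1) + christoffel_mat a x i *v X x) $ m"
  using partial_deriv_eq[OF bounded_linear.has_derivative[OF bounded_linear_vec_nth assms]]
  by (simp add: nabla_vec_def christoffel_mat_def matrix_vector_mult_def)

text \<open>Lowering an index commutes with the covariant derivative because nabla a = 0. It turns
  the contraction of y with the covariant derivative of the 1-form into an inner product of y with
  that of E.\<close>

lemma nabla_covec_lower:
  assumes x: "x \<in> U" and X: "(X has_derivative X') (at x)"
    and lower: "\<And>z. z \<in> U \<Longrightarrow> \<omega> z = a z *v X z"
  shows "nabla_covec a \<omega> x i h = (a x *v (X' (axis i 1) + christoffel_mat a x i *v X x)) $ h"
proof -
  let ?e = "axis i 1 :: real ^ 'n" and ?G = "christoffel_mat a x i"
  have "((\<lambda>z. a z *v X z) has_derivative (\<lambda>v. a x *v X' v + frechet_derivative a (at x) v *v X x)) (at x)"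
    by (rule bounded_bilinear.FDERIV[OF bounded_bilinear_matrix_vector_mult a_has_derivative[OF x] X])
  then have "(\<omega> has_derivative (\<lambda>v. a x *v X' v + frechet_derivative a (at x) v *v X x)) (at x)"
    by (rule has_derivative_transform_within_open[OF _ open_U x]) (simp add: lower)
  from partial_deriv_eq[OF bounded_linear.has_derivative[OF bounded_linear_vec_nth this]]
  have "partial_deriv i (\<lambda>z. \<omega> z $ h) x = (a x *v X' ?e + frechet_derivative a (at x) ?e *v X x) $ h" .
  moreover have "(\<Sum>k\<in>UNIV. christoffel a x k h i * \<omega> x $ k) = X x \<bullet> (a x *v (?G *v axis h 1))"
    unfolding a_inner_commute[OF x, of "X x"] lower[OF x, symmetric]
    by (simp add: inner_vec_def matrix_vector_mult_basis column_def christoffel_mat_def)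
  moreover have "(frechet_derivative a (at x) ?e *v X x) $ h =
      (a x *v (?G *v X x)) $ h + X x \<bullet> (a x *v (?G *v axis h 1))"
    using metric_compatible[OF x, of "axis h 1" i "X x"] by (simp add: inner_axis')
  ultimately show ?thesis
    by (simp add: nabla_covec_def matrix_vector_right_distrib)
qed

text \<open>Differentiating the constant squared length gives twice this inner product, by metric
  compatibility.\<close>

lemma unit_field_nabla_orthogonal:
  assumes x: "x \<in> U" and X: "(X has_derivative X') (at x)"
    and unit: "\<And>z. z \<in> U \<Longrightarrow> X z \<bullet> (a z *v X z) = 1"
  shows "X x \<bullet> (a x *v (X' (axis i 1) + christoffel_mat a x i *v X x)) = 0"
proof -
  let ?e = "axis i 1 :: real ^ 'n" and ?A = "frechet_derivative a (at x)"
  have "((\<lambda>z. a z *v X z) has_derivative (\<lambda>v. a x *v X' v + ?A v *v X x)) (at x)"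
    by (rule bounded_bilinear.FDERIV[OF bounded_bilinear_matrix_vector_mult a_has_derivative[OF x] X])
  from has_derivative_inner[OF X this]
  have "((\<lambda>z. X z \<bullet> (a z *v X z)) has_derivative
      (\<lambda>v. X x \<bullet> (a x *v X' v + ?A v *v X x) + X' v \<bullet> (a x *v X x))) (at x)" .
  moreover have "((\<lambda>z. X z \<bullet> (a z *v X z)) has_derivative (\<lambda>_. 0)) (at x)"
    by (rule has_derivative_transform_within_open[OF has_derivative_const[of 1] open_U x])
      (simp add: unit)
  ultimately have "(\<lambda>v. X x \<bullet> (a x *v X' v + ?A v *v X x) + X' v \<bullet> (a x *v X x)) = (\<lambda>_. 0)"
    by (rule has_derivative_unique)
  from fun_cong[OF this, of ?e]
  have "X x \<bullet> (a x *v X' ?e + ?A ?e *v X x) + X' ?e \<bullet> (a x *v X x) = 0" .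
  then show ?thesis
    using metric_compatible[OF x, of "X x" i "X x"] a_inner_commute[OF x, of "X x" "X' ?e"]
    by (simp add: matrix_vector_right_distrib inner_add_right)
qed

end

section \<open>The frame of the 1-form and the transformation\<close>

locale riemannian_chart_form = riemannian_chart U a
  for U :: "(real ^ 'n::finite) set" and a +
  fixes b :: "real ^ 'n \<Rightarrow> real ^ 'n" and c :: real
  assumes b_smooth: "smooth_on U b"
    and c_norm_eq: "\<And>x. x \<in> U \<Longrightarrow> c_norm a b x = c"
    and c_pos: "0 < c" and c_less_1: "c < 1"
begin

abbreviation "E \<equiv> bt_up a b"

lemma b_form_eq: "x \<in> U \<Longrightarrow> b_form b x y = c * bt_form a b x y"
  using c_pos by (simp add: b_form_def bt_form_def bt_low_def c_norm_eq sum_distrib_left)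

lemma bt_form_inner: "bt_form a b x y = bt_low a b x \<bullet> y"
  by (simp add: bt_form_def inner_vec_def)

lemma E_eq: "x \<in> U \<Longrightarrow> E x = (1 / c) *\<^sub>R (matrix_inv (a x) *v b x)"
  by (simp add: vec_eq_iff bt_up_def b_up_def c_norm_eq matrix_vector_mult_def)

lemma bt_low_eq: "x \<in> U \<Longrightarrow> bt_low a b x = a x *v E x"
  by (simp add: E_eq matrix_vector_mult_scaleR matrix_vector_mul_assoc matrix_inv_mult
      a_invertible vec_eq_iff bt_low_def c_norm_eq)

lemma bt_form_eq: "x \<in> U \<Longrightarrow> bt_form a b x y = y \<bullet> (a x *v E x)"
  by (simp add: bt_form_inner bt_low_eq inner_commute)

lemma E_unit: assumes x: "x \<in> U" shows "E x \<bullet> (a x *v E x) = 1"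
proof -
  have "sqrt (b x \<bullet> (matrix_inv (a x) *v b x)) = c"
    using c_norm_eq[OF x] unfolding c_norm_def quadratic_sum_eq_inner .
  then have "b x \<bullet> (matrix_inv (a x) *v b x) = c\<^sup>2"
    using c_pos by (metis real_sqrt_gt_0_iff real_sqrt_pow2 less_eq_real_def)
  moreover have "E x \<bullet> (a x *v E x) = (1 / c\<^sup>2) * (b x \<bullet> (matrix_inv (a x) *v b x))"
    unfolding bt_low_eq[OF x, symmetric]
    by (simp add: E_eq[OF x] bt_low_def c_norm_eq[OF x] inner_vec_def sum_distrib_left
        power2_eq_square mult_ac sum_divide_distrib)
  ultimately show ?thesis using c_pos by simp
qed

lemma E_differentiable: assumes x: "x \<in> U" shows "E differentiable (at x)"
proof -
  have "(\<lambda>z. matrix_inv (a z) *v b z) differentiable (at x)"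
    by (rule differentiable_matrix_inv_mult[OF a_differentiable[OF x]
        smooth_on_differentiable[OF b_smooth open_U x] open_U x a_invertible])
  then have "(\<lambda>z. (1 / c) *\<^sub>R (matrix_inv (a z) *v b z)) differentiable (at x)"
    by (intro differentiable_scaleR differentiable_const)
  then obtain D where "((\<lambda>z. (1 / c) *\<^sub>R (matrix_inv (a z) *v b z)) has_derivative D) (at x)"
    unfolding differentiable_def by blast
  then have "(E has_derivative D) (at x)"
    by (rule has_derivative_transform_within_open[OF _ open_U x]) (simp add: E_eq)
  then show ?thesis by (rule differentiableI)
qed

text \<open>Pythagoras for the splitting along the unit vector E. It yields the Cauchy-Schwarz bound
  \<open>bt_form_le\<close> and identifies \<open>qt\<close> with the length of the part of y
  orthogonal to E.\<close>

lemma orth_part_norm: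
  assumes x: "x \<in> U"
  shows "(y - bt_form a b x y *\<^sub>R E x) \<bullet> (a x *v (y - bt_form a b x y *\<^sub>R E x)) =
    y \<bullet> (a x *v y) - (bt_form a b x y)\<^sup>2"
  using a_inner_commute[OF x, of "E x" y] E_unit[OF x]
  by (simp add: matrix_vector_mult_diff_distrib matrix_vector_mult_scaleR inner_diff_left
      inner_diff_right bt_form_eq[OF x] power2_eq_square)

lemma bt_form_le: "x \<in> U \<Longrightarrow> (bt_form a b x y)\<^sup>2 \<le> y \<bullet> (a x *v y)"
  using orth_part_norm[of x y] a_nonneg[of x "y - bt_form a b x y *\<^sub>R E x"] by linarith

text \<open>Here c < 1 is used: b^2 = c^2 bt^2 is at most bt^2, so the radicand is nonnegative. For
  a negative radicand squaring the root would give its absolute value.\<close>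

lemma q_fun_sq:
  assumes x: "x \<in> U"
  shows "(q_fun a b x y)\<^sup>2 = y \<bullet> (a x *v y) - (b_form b x y)\<^sup>2" and "q_fun a b x y \<ge> 0"
proof -
  have "c\<^sup>2 * (bt_form a b x y)\<^sup>2 \<le> 1 * (bt_form a b x y)\<^sup>2"
    using c_pos c_less_1 by (intro mult_right_mono) (simp_all add: power_le_one)
  then have "(b_form b x y)\<^sup>2 \<le> y \<bullet> (a x *v y)"
    using bt_form_le[OF x, of y] by (simp add: b_form_eq[OF x] power_mult_distrib)
  then show "(q_fun a b x y)\<^sup>2 = y \<bullet> (a x *v y) - (b_form b x y)\<^sup>2" "q_fun a b x y \<ge> 0"
    by (simp_all add: q_fun_def quadratic_sum_eq_inner)
qed

text \<open>The correction (1 - 1/c^2) b^2 replaces b^2 by b^2/c^2 = bt^2, which makes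
  \<open>qt\<close> geometric, independent of the length of b.\<close>

lemma qt_fun_eq: "x \<in> U \<Longrightarrow> qt_fun a b x y = sqrt (y \<bullet> (a x *v y) - (bt_form a b x y)\<^sup>2)"
  using c_pos unfolding qt_fun_def
  by (simp add: q_fun_sq c_norm_eq b_form_eq field_simps)

lemma qt_fun_sq: "x \<in> U \<Longrightarrow> (qt_fun a b x y)\<^sup>2 = y \<bullet> (a x *v y) - (bt_form a b x y)\<^sup>2"
  using bt_form_le[of x y] by (simp add: qt_fun_eq)

lemma i_vec_eq: "x \<in> U \<Longrightarrow> i_vec a b x y = (1 / qt_fun a b x y) *\<^sub>R (y - bt_form a b x y *\<^sub>R E x)"
  using c_pos by (simp add: vec_eq_iff i_vec_def bt_up_def c_norm_eq b_form_eq power2_eq_square)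

lemma i_vec_orth: "x \<in> U \<Longrightarrow> i_vec a b x y \<bullet> (a x *v E x) = 0"
  by (simp add: i_vec_eq inner_diff_left E_unit bt_form_eq)

lemma i_vec_unit:
  assumes "x \<in> U" "qt_fun a b x y > 0"
  shows "i_vec a b x y \<bullet> (a x *v i_vec a b x y) = 1"
  using assms(2) orth_part_norm[OF assms(1), of y, folded qt_fun_sq[OF assms(1)]]
  by (simp add: i_vec_eq[OF assms(1)] matrix_vector_mult_scaleR power2_eq_square)

lemma frame_decomp:
  "x \<in> U \<Longrightarrow> qt_fun a b x y > 0 \<Longrightarrow> y = bt_form a b x y *\<^sub>R E x + qt_fun a b x y *\<^sub>R i_vec a b x y"
  by (simp add: i_vec_eq)

text \<open>Converse of \<open>frame_decomp\<close>: the coordinates relative to E are unique. This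
  allows vectors with prescribed \<open>bt\<close>, \<open>qt\<close> and direction to be built, and
  hence paths along which chosen invariants do not move.\<close>

lemma frame_coords:
  assumes x: "x \<in> U" and unit: "I \<bullet> (a x *v I) = 1" and orth: "I \<bullet> (a x *v E x) = 0" and r: "r > 0"
  shows "bt_form a b x (\<beta> *\<^sub>R E x + r *\<^sub>R I) = \<beta>"
    and "qt_fun a b x (\<beta> *\<^sub>R E x + r *\<^sub>R I) = r"
    and "i_vec a b x (\<beta> *\<^sub>R E x + r *\<^sub>R I) = I"
proof -
  show \<beta>: "bt_form a b x (\<beta> *\<^sub>R E x + r *\<^sub>R I) = \<beta>"
    using E_unit[OF x] orth by (simp add: bt_form_eq[OF x] inner_add_left)
  have "(qt_fun a b x (\<beta> *\<^sub>R E x + r *\<^sub>R I))\<^sup>2 = r\<^sup>2"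
    using orth_part_norm[OF x, of "\<beta> *\<^sub>R E x + r *\<^sub>R I"] unit
    unfolding qt_fun_sq[OF x] \<beta> by (simp add: matrix_vector_mult_scaleR power2_eq_square)
  moreover have "qt_fun a b x (\<beta> *\<^sub>R E x + r *\<^sub>R I) \<ge> 0"
    using bt_form_le[OF x] by (simp add: qt_fun_eq[OF x])
  ultimately show q: "qt_fun a b x (\<beta> *\<^sub>R E x + r *\<^sub>R I) = r"
    using r by (simp add: power2_eq_iff)
  show "i_vec a b x (\<beta> *\<^sub>R E x + r *\<^sub>R I) = I"
    using r by (simp add: i_vec_eq[OF x] \<beta> q)
qed

text \<open>Ties the one-variable function differentiated in the condition on rho to the actual w;
  the nonnegative root is the right one because q is nonnegative and b positive.\<close>

lemma w_of_wt_eq: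
  assumes x: "x \<in> U" and b: "b_form b x y > 0" and s: "wt_fun a b x y = s"
  shows "w_of_wt a b x s = w_fun a b x y"
proof -
  have *: "(qt_fun a b x y)\<^sup>2 = (q_fun a b x y)\<^sup>2 + (1 - 1 / c\<^sup>2) * (b_form b x y)\<^sup>2"
    using c_pos by (simp add: qt_fun_sq[OF x] q_fun_sq[OF x] b_form_eq[OF x] field_simps)
  have "s\<^sup>2 = (w_fun a b x y)\<^sup>2 + (1 - 1 / c\<^sup>2)"
    unfolding s[symmetric] wt_fun_def w_fun_def power_divide * using b by (simp add: add_divide_distrib)
  then show ?thesis
    using b q_fun_sq(2)[OF x, of y] by (simp add: w_of_wt_def c_norm_eq[OF x] w_fun_def)
qed

text \<open>Constancy of c matters here: fixing \<open>bt\<close> and \<open>qt\<close> now fixes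
  \<open>wt\<close>, and with it F, even while x moves.\<close>

lemma wt_fun_eq: "x \<in> U \<Longrightarrow> wt_fun a b x y = qt_fun a b x y / (c * bt_form a b x y)"
  by (simp add: wt_fun_def b_form_eq)

end

section \<open>The components of t in the frame I, E\<close>

locale conformal_FS_space = riemannian_chart_form U a b c
  for U :: "(real ^ 'n::finite) set" and a b c +
  fixes D :: "((real ^ 'n) \<times> (real ^ 'n)) set"
    and F :: "real ^ 'n \<Rightarrow> real ^ 'n \<Rightarrow> real"
    and V :: "real \<Rightarrow> real"
    and C C1 :: "real ^ 'n \<Rightarrow> real"
    and \<rho> :: "real ^ 'n \<Rightarrow> real \<Rightarrow> real"
    and t :: "real ^ 'n \<Rightarrow> real ^ 'n \<Rightarrow> real ^ 'n"
    and H :: real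
  assumes dom: "conic_domain U D"
    and dom_pos: "\<And>x y. (x, y) \<in> D \<Longrightarrow> b_form b x y > 0 \<and> qt_fun a b x y > 0"
    and finsler: "finsler_metric_on D F"
    and F_eq: "\<And>x y. (x, y) \<in> D \<Longrightarrow> F x y = b_form b x y * V (wt_fun a b x y)"
    and C_range: "\<And>x. x \<in> U \<Longrightarrow> C x > 0 \<and> C x > \<bar>C1 x\<bar>"
    and rho_range: "\<And>x y. (x, y) \<in> D \<Longrightarrow> 0 < \<rho> x (w_fun a b x y) \<and> \<rho> x (w_fun a b x y) < pi"
    and rho_mu: "\<And>x y. (x, y) \<in> D \<Longrightarrow>
      mu_fun C C1 x (\<rho> x (w_fun a b x y)) =
        tau_fun V (wt_fun a b x y) / (wt_fun a b x y)\<^sup>2 * (sin (\<rho> x (w_fun a b x y)))\<^sup>2"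
    and rho_deriv: "\<And>x y. (x, y) \<in> D \<Longrightarrow>
      ((\<lambda>s. \<rho> x (w_of_wt a b x s)) has_real_derivative
        1 / wt_fun a b x y * sqrt (rad_tau V (wt_fun a b x y) / tau_fun V (wt_fun a b x y)) *
        sin (\<rho> x (w_fun a b x y))) (at (wt_fun a b x y))"
    and t_eq: "\<And>x y m. (x, y) \<in> D \<Longrightarrow>
      t x y $ m =
        (i_vec a b x y $ m * sin (\<rho> x (w_fun a b x y)) +
         1 / (2 * k_breve C C1 x) *
           (1 - (k_breve C C1 x)\<^sup>2 + (1 + (k_breve C C1 x)\<^sup>2) * cos (\<rho> x (w_fun a b x y))) *
           bt_up a b x $ m) *
        (H_deg C C1 x / sqrt (mu_fun C C1 x (\<rho> x (w_fun a b x y)))) * F x y powr H_deg C C1 x"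
    and conf: "conformal_automorphism D a F (H_deg C C1) t"
    and H_eq: "\<And>x. x \<in> U \<Longrightarrow> H_deg C C1 x = H"
begin

definition "rh x y = \<rho> x (w_fun a b x y)"
definition "M x r = C x + C1 x * cos r"
text \<open>\<open>sg\<close> and \<open>kp\<close> are the components of t / F^H along I and E, and
  \<open>M\<close> is sqrt mu. Together they are the sine and cosine of a new angle, given by the
  formula that relates eccentric and true anomaly (or describes relativistic aberration).\<close>

definition "sg x r = H * sin r / M x r"
definition "kp x r = (C1 x + C x * cos r) / M x r"

lemma D_U: "(x, y) \<in> D \<Longrightarrow> x \<in> U"
  using dom by (auto simp: conic_domain_def)

lemma open_D: "open D"
  using dom by (simp add: conic_domain_def)

lemma bt_pos: "(x, y) \<in> D \<Longrightarrow> bt_form a b x y > 0"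
  using dom_pos[of x y] D_U[of x y] c_pos by (simp add: b_form_eq zero_less_mult_iff)

lemma qt_pos: "(x, y) \<in> D \<Longrightarrow> qt_fun a b x y > 0"
  using dom_pos by blast

lemma wt_pos: "(x, y) \<in> D \<Longrightarrow> wt_fun a b x y > 0"
  using dom_pos by (simp add: wt_fun_def)

lemma F_pos: "(x, y) \<in> D \<Longrightarrow> F x y > 0"
  using finsler by (auto simp: finsler_metric_on_def)

lemma V_pos: "(x, y) \<in> D \<Longrightarrow> V (wt_fun a b x y) > 0"
  using F_pos[of x y] F_eq[of x y] dom_pos[of x y] by (simp add: zero_less_mult_iff)

lemma C_sum_pos: "x \<in> U \<Longrightarrow> C x + C1 x > 0" "x \<in> U \<Longrightarrow> C x - C1 x > 0"
  using C_range[of x] by auto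

lemma H_sq: "x \<in> U \<Longrightarrow> H\<^sup>2 = (C x)\<^sup>2 - (C1 x)\<^sup>2"
  and H_pos: "x \<in> U \<Longrightarrow> H > 0"
proof -
  assume x: "x \<in> U"
  have "(C x)\<^sup>2 - (C1 x)\<^sup>2 = (C x + C1 x) * (C x - C1 x)"
    by (simp add: power2_eq_square algebra_simps)
  then have "(C x)\<^sup>2 - (C1 x)\<^sup>2 > 0" using C_sum_pos[OF x] by simp
  then show "H\<^sup>2 = (C x)\<^sup>2 - (C1 x)\<^sup>2" "H > 0"
    using H_eq[OF x] by (auto simp: H_deg_def)
qed

lemma M_pos: assumes "x \<in> U" shows "M x r > 0"
proof -
  have "\<bar>C1 x * cos r\<bar> \<le> \<bar>C1 x\<bar>"
    unfolding abs_mult by (rule mult_left_le) auto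
  then show ?thesis unfolding M_def using C_range[OF assms] by linarith
qed

lemma sqrt_mu: "x \<in> U \<Longrightarrow> sqrt (mu_fun C C1 x r) = M x r"
  using sqrt_mu_fun(2)[of C1 x C r] C_range by (simp add: M_def)

lemma mu_eq: "x \<in> U \<Longrightarrow> mu_fun C C1 x r = (M x r)\<^sup>2"
  unfolding sqrt_mu[symmetric] by (rule real_sqrt_pow2[symmetric]) (simp add: mu_fun_def)

text \<open>Forced by the condition on mu: the positive number mu is tau times a square. In
  particular the derivative of V cannot vanish on the domain, since division by zero would make tau
  zero.\<close>

lemma tau_pos: assumes "(x, y) \<in> D" shows "tau_fun V (wt_fun a b x y) > 0"
proof -
  have "sin (\<rho> x (w_fun a b x y)) > 0"
    using rho_range[OF assms] by (simp add: sin_gt_zero)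
  moreover have "tau_fun V (wt_fun a b x y) * ((sin (\<rho> x (w_fun a b x y)))\<^sup>2 / (wt_fun a b x y)\<^sup>2) > 0"
    using rho_mu[OF assms] zero_less_power[OF M_pos[OF D_U[OF assms]], of _ 2]
    by (metis mu_eq[OF D_U[OF assms]] times_divide_eq_left times_divide_eq_right)
  ultimately show ?thesis
    by (metis zero_le_divide_iff zero_le_power2 zero_less_mult_iff order.asym not_le)
qed

lemma sin_rh_pos: "(x, y) \<in> D \<Longrightarrow> sin (rh x y) > 0"
  using rho_range by (simp add: rh_def sin_gt_zero)

text \<open>The condition on mu is a perfect square on both sides. Since sin rho > 0, its positive
  root makes sin rho cancel in \<open>sg\<close>, so C, C1 and rho disappear and only H and
  \<open>wt\<close> remain.\<close>

lemma sg_eq: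
  assumes D: "(x, y) \<in> D"
  shows "sg x (rh x y) = H * wt_fun a b x y / sqrt (tau_fun V (wt_fun a b x y))"
proof -
  note x = D_U[OF D]
  have "(M x (rh x y))\<^sup>2 = (sqrt (tau_fun V (wt_fun a b x y)) / wt_fun a b x y * sin (rh x y))\<^sup>2"
    using rho_mu[OF D] tau_pos[OF D] by (simp add: mu_eq[OF x] rh_def power_mult_distrib power_divide)
  then have "M x (rh x y) = sqrt (tau_fun V (wt_fun a b x y)) / wt_fun a b x y * sin (rh x y)"
    by (rule power2_eq_imp_eq)
      (simp_all add: less_imp_le M_pos[OF x] tau_pos[OF D] wt_pos[OF D] sin_rh_pos[OF D])
  then show ?thesis
    using sin_rh_pos[OF D] wt_pos[OF D] tau_pos[OF D] by (simp add: sg_def)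
qed

text \<open>Expresses that t has Riemannian length F^H, and determines \<open>kp\<close> from
  \<open>sg\<close> up to sign. The computation rests on H^2 = C^2 - C1^2.\<close>

lemma sg_kp: assumes "x \<in> U" shows "(sg x r)\<^sup>2 + (kp x r)\<^sup>2 = 1"
proof -
  have "(H * sin r)\<^sup>2 + (C1 x + C x * cos r)\<^sup>2 = (M x r)\<^sup>2"
    unfolding power_mult_distrib H_sq[OF assms] sin_squared_eq M_def
    by (simp add: power2_eq_square algebra_simps)
  then show ?thesis
    using M_pos[OF assms, of r] unfolding sg_def kp_def power_divide
    by (simp add: add_divide_distrib[symmetric])
qed

lemma t_frame:
  assumes D: "(x, y) \<in> D"
  shows "t x y = (F x y powr H) *\<^sub>R (sg x (rh x y) *\<^sub>R i_vec a b x y + kp x (rh x y) *\<^sub>R E x)"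
proof -
  note x = D_U[OF D]
  have k: "k_breve C C1 x > 0" "(k_breve C C1 x)\<^sup>2 = (C x - C1 x) / (C x + C1 x)"
    using C_sum_pos[OF x] by (simp_all add: k_breve_def)
  have "H = sqrt ((k_breve C C1 x * (C x + C1 x))\<^sup>2)"
    unfolding power_mult_distrib k(2) H_eq[OF x, symmetric] H_deg_def using C_sum_pos[OF x]
    by (simp add: power2_eq_square field_simps)
  then have Hk: "H = k_breve C C1 x * (C x + C1 x)"
    using k C_sum_pos[OF x] by simp
  \<comment> \<open>Used with s = C + C1 and d = C - C1, so that s - d = 2 C1 and s + d = 2 C: the
    E-coefficient of the given formula, times H, is C1 + C cos rho.\<close>
  have "k * s * (1 / (2 * k) * (1 - d / s + (1 + d / s) * z)) = ((s - d) + (s + d) * z) / 2"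
    if "k > 0" "s > 0" for k s d z :: real
    using that by (simp add: field_simps)
  note * = this[OF k(1) C_sum_pos(1)[OF x]]
  have "H * (1 / (2 * k_breve C C1 x) *
           (1 - (k_breve C C1 x)\<^sup>2 + (1 + (k_breve C C1 x)\<^sup>2) * z)) = C1 x + C x * z" for z
    unfolding k(2) Hk * by simp
  moreover have "P / N = X * (H / N)" if "H * X = P" for P X N
    using that by auto
  moreover define f where "f = 1 / (2 * k_breve C C1 x) *
      (1 - (k_breve C C1 x)\<^sup>2 + (1 + (k_breve C C1 x)\<^sup>2) * cos (rh x y))"
  ultimately have kp: "kp x (rh x y) = f * (H / M x (rh x y))"
    unfolding kp_def by blast
  have "t x y $ m = (i_vec a b x y $ m * sin (rh x y) + f * E x $ m) * (H / M x (rh x y)) * F x y powr H"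
    for m
    unfolding f_def t_eq[OF D] H_eq[OF x] sqrt_mu[OF x] rh_def ..
  then show ?thesis
    by (simp add: vec_eq_iff kp sg_def algebra_simps add_divide_distrib)
qed

text \<open>As F^H > 0, b^* has the sign of \<open>kp\<close>. Read the other way, it recovers
  \<open>kp\<close> from t.\<close>

lemma bt_form_t: "(x, y) \<in> D \<Longrightarrow> bt_form a b x (t x y) = F x y powr H * kp x (rh x y)"
  by (simp add: bt_form_eq t_frame D_U inner_add_left i_vec_orth E_unit)

lemma t_differentiable: "(x, y) \<in> D \<Longrightarrow> (\<lambda>(x, y). t x y) differentiable (at (x, y))"
  using conf smooth_on_differentiable[OF _ open_D] by (auto simp: conformal_automorphism_def)

lemma F_differentiable: "(x, y) \<in> D \<Longrightarrow> (\<lambda>(x, y). F x y) differentiable (at (x, y))"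
  using finsler smooth_on_differentiable[OF _ open_D] by (auto simp: finsler_metric_on_def)

section \<open>The differential of the transformation\<close>

text \<open>The joint differential in (x, y), so that moving both at once is a single evaluation.
  The Jacobian J in y is v mapped to \<open>Dt x y (0, v)\<close>.\<close>

definition "Dt x y = frechet_derivative (\<lambda>(x, y). t x y) (at (x, y))"

lemma t_has_derivative: "(x, y) \<in> D \<Longrightarrow> ((\<lambda>(x, y). t x y) has_derivative Dt x y) (at (x, y))"
  using t_differentiable[of x y] by (simp add: frechet_derivative_works[symmetric] Dt_def)

lemma linear_Dt: "(x, y) \<in> D \<Longrightarrow> linear (Dt x y)"
  using t_has_derivative has_derivative_linear by blast

lemma t_path_derivative:
  assumes D: "(x, y) \<in> D"
    and z: "(z has_vector_derivative e) (at 0)" "z 0 = x"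
    and p: "(p has_vector_derivative w) (at 0)" "p 0 = y"
  shows "((\<lambda>s. t (z s) (p s)) has_vector_derivative Dt x y (e, w)) (at 0)"
  using has_vector_derivative_comp_path[of "\<lambda>(x, y). t x y" "Dt x y" "\<lambda>s. (z s, p s)" 0 "(e, w)"]
    t_has_derivative[OF D] has_vector_derivative_Pair[OF z(1) p(1)] z(2) p(2)
  by simp

lemma eventually_D:
  assumes D: "(x, y) \<in> D"
    and z: "(z has_vector_derivative e) (at 0)" "z 0 = x"
    and p: "(p has_vector_derivative w) (at 0)" "p 0 = y"
  shows "\<forall>\<^sub>F s in nhds 0. (z s, p s) \<in> D"
proof -
  have "isCont (\<lambda>s. (z s, p s)) 0"
    using has_vector_derivative_continuous[OF has_vector_derivative_Pair[OF z(1) p(1)]] .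
  then have "((\<lambda>s. (z s, p s)) \<longlongrightarrow> (x, y)) (nhds 0)"
    using z(2) p(2) by (auto dest: isCont_tendsto_nhds)
  then show ?thesis using topological_tendstoD[OF _ open_D] D by blast
qed

text \<open>A velocity that keeps \<open>bt\<close> and the length of y to first order moves t only
  through the frame: the coefficients of I and E in t stay fixed, and I moves with velocity (w - bt
  E') / qt. It serves twice, with x moving and, for e = 0, for rotations about E.\<close>

lemma Dt_isometric:
  assumes D: "(x, y) \<in> D"
    and E': "((\<lambda>s. E (x + s *\<^sub>R e)) has_vector_derivative E') (at 0)"
    and bt': "((\<lambda>s. bt_form a b (x + s *\<^sub>R e) (y + s *\<^sub>R w)) has_real_derivative 0) (at 0)"
    and S': "((\<lambda>s. (y + s *\<^sub>R w) \<bullet> (a (x + s *\<^sub>R e) *v (y + s *\<^sub>R w))) has_real_derivative 0) (at 0)"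
  shows "Dt x y (e, w) = (F x y powr H) *\<^sub>R
    ((sg x (rh x y) / qt_fun a b x y) *\<^sub>R (w - bt_form a b x y *\<^sub>R E') + kp x (rh x y) *\<^sub>R E')"
proof -
  note x = D_U[OF D]
  define \<beta> where "\<beta> = bt_form a b x y"
  define r where "r = qt_fun a b x y"
  define z where "z s = x + s *\<^sub>R e" for s
  define y1 where "y1 s = y + s *\<^sub>R w" for s
  define Q where "Q s = y1 s \<bullet> (a (z s) *v y1 s) - (bt_form a b (z s) (y1 s))\<^sup>2" for s
  define I where "I s = (1 / sqrt (Q s)) *\<^sub>R (y1 s - bt_form a b (z s) (y1 s) *\<^sub>R E (z s))" for s
  \<comment> \<open>The straight path keeps the invariants only to first order. \<open>y2\<close> is
    rebuilt from the moving frame with the coordinates of y, so it keeps them exactly, and it has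
    the same velocity w; here \<open>Q\<close> is the squared \<open>qt\<close> of the straight
    path.\<close>
  define y2 where "y2 s = \<beta> *\<^sub>R E (z s) + r *\<^sub>R I s" for s
  have z0: "z 0 = x" and y10: "y1 0 = y" by (simp_all add: z_def y1_def)
  have r: "r > 0" and Q0: "Q 0 = r\<^sup>2" "Q 0 > 0"
    using qt_pos[OF D] by (simp_all add: Q_def z0 y10 r_def qt_fun_sq[OF x, symmetric])
  have z': "(z has_vector_derivative e) (at 0)" and y1': "(y1 has_vector_derivative w) (at 0)"
    unfolding z_def y1_def by (rule line_derivative)+
  have "(Q has_real_derivative 0) (at 0)"
    unfolding Q_def using bt' S' unfolding z_def y1_def
    by (auto intro!: derivative_eq_intros)
  then have iQ': "((\<lambda>s. 1 / sqrt (Q s)) has_real_derivative 0) (at 0)"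
    using Q0(2) by (auto intro!: derivative_eq_intros)
  have I': "(I has_vector_derivative (1 / r) *\<^sub>R (w - \<beta> *\<^sub>R E')) (at 0)"
  proof -
    have "((\<lambda>s. bt_form a b (z s) (y1 s) *\<^sub>R E (z s)) has_vector_derivative
        bt_form a b (z 0) (y1 0) *\<^sub>R E' + 0 *\<^sub>R E (z 0)) (at 0)"
      by (rule has_vector_derivative_scaleR) (use bt' E' in \<open>simp_all add: z_def y1_def\<close>)
    then have "((\<lambda>s. y1 s - bt_form a b (z s) (y1 s) *\<^sub>R E (z s)) has_vector_derivative w - \<beta> *\<^sub>R E') (at 0)"
      using has_vector_derivative_diff[OF y1'] by (simp add: \<beta>_def z0 y10)
    from has_vector_derivative_scaleR[OF iQ' this]
    show ?thesis unfolding I_def using Q0 r by simp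
  qed
  have y2': "(y2 has_vector_derivative w) (at 0)"
  proof -
    have "(y2 has_vector_derivative \<beta> *\<^sub>R E' + r *\<^sub>R ((1 / r) *\<^sub>R (w - \<beta> *\<^sub>R E'))) (at 0)"
      unfolding y2_def using E' I'
      by (intro has_vector_derivative_add has_vector_derivative_scaleR_right) (simp_all add: z_def)
    then show ?thesis using r by simp
  qed
  have I0: "I 0 = i_vec a b x y"
    using r by (simp add: I_def i_vec_eq[OF x] Q0 z0 y10 r_def)
  have y20: "y2 0 = y"
    using frame_decomp[OF x qt_pos[OF D]] by (simp add: y2_def I0 z0 \<beta>_def r_def)
  have evD: "\<forall>\<^sub>F s in nhds 0. (z s, y2 s) \<in> D"
    by (rule eventually_D[OF D z' z0 y2' y20])
  have contQ: "isCont Q 0"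
    using \<open>(Q has_real_derivative 0) (at 0)\<close> DERIV_isCont by blast
  have evQ: "\<forall>\<^sub>F s in nhds 0. Q s > 0"
    using order_tendstoD(1)[OF isCont_tendsto_nhds[OF contQ] Q0(2)] .
  have frame: "bt_form a b (z s) (y2 s) = \<beta>" "qt_fun a b (z s) (y2 s) = r" "i_vec a b (z s) (y2 s) = I s"
    if "(z s, y2 s) \<in> D" "Q s > 0" for s
  proof -
    note zU = D_U[OF that(1)]
    have q: "qt_fun a b (z s) (y1 s) = sqrt (Q s)"
      by (simp add: Q_def qt_fun_eq[OF zU])
    then have "I s = i_vec a b (z s) (y1 s)"
      by (simp add: I_def i_vec_eq[OF zU])
    then have "I s \<bullet> (a (z s) *v I s) = 1" "I s \<bullet> (a (z s) *v E (z s)) = 0"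
      using i_vec_unit[OF zU, of "y1 s"] i_vec_orth[OF zU] q that(2) by simp_all
    from frame_coords[OF zU this r]
    show "bt_form a b (z s) (y2 s) = \<beta>" "qt_fun a b (z s) (y2 s) = r" "i_vec a b (z s) (y2 s) = I s"
      by (simp_all add: y2_def)
  qed
  have wt: "wt_fun a b (z s) (y2 s) = wt_fun a b x y" if "(z s, y2 s) \<in> D" "Q s > 0" for s
    using frame[OF that] D_U[OF that(1)] x by (simp add: wt_fun_eq \<beta>_def r_def)
  have F: "F (z s) (y2 s) = F x y" if "(z s, y2 s) \<in> D" "Q s > 0" for s
    using wt[OF that] frame[OF that] D_U[OF that(1)] x
    by (simp add: F_eq[OF that(1)] F_eq[OF D] b_form_eq \<beta>_def)
  have sg: "sg (z s) (rh (z s) (y2 s)) = sg x (rh x y)" if "(z s, y2 s) \<in> D" "Q s > 0" for s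
    using wt[OF that] by (simp add: sg_eq[OF D] sg_eq[OF that(1)])
  \<comment> \<open>Reading \<open>kp\<close> off from t makes its continuity along the path a
    consequence of that of t, E and a.\<close>
  define \<kappa> where "\<kappa> s = bt_form a b (z s) (t (z s) (y2 s)) / F x y powr H" for s
  have kp: "\<kappa> s = kp (z s) (rh (z s) (y2 s))" if "(z s, y2 s) \<in> D" "Q s > 0" for s
    using F_pos[OF D] by (simp add: \<kappa>_def bt_form_t[OF that(1)] F[OF that])
  have kp0: "\<kappa> 0 = kp x (rh x y)"
    using kp[of 0] D Q0(2) by (simp add: z0 y20)
  have kp_sq: "(\<kappa> s)\<^sup>2 = (\<kappa> 0)\<^sup>2" if "(z s, y2 s) \<in> D" "Q s > 0" for s
    using sg_kp[OF x, of "rh x y"] sg_kp[OF D_U[OF that(1)], of "rh (z s) (y2 s)"]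
    by (simp add: kp[OF that] kp0 sg[OF that])
  \<comment> \<open>\<open>\<kappa>\<^sup>2\<close> is constant along the path and \<open>\<kappa>\<close> is continuous, so \<open>\<kappa>\<close> itself cannot jump between its two
    possible values.\<close>
  have "isCont \<kappa> 0"
  proof -
    have "isCont (\<lambda>s. t (z s) (y2 s)) 0"
      using has_vector_derivative_continuous[OF t_path_derivative[OF D z' z0 y2' y20]] .
    moreover have "isCont (\<lambda>s. E (z s)) 0"
      using has_vector_derivative_continuous[OF E'] by (simp add: z_def)
    moreover have "isCont (\<lambda>s. a (z s)) 0"
      using has_vector_derivative_continuous[OF has_vector_derivative_comp_path[of a _ z 0 e]]
        a_has_derivative[OF x] z' by (simp add: z0)
    ultimately have "isCont (\<lambda>s. (t (z s) (y2 s) \<bullet> (a (z s) *v E (z s))) / F x y powr H) 0"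
      using F_pos[OF D]
      by (intro continuous_intros bounded_bilinear.continuous[OF bounded_bilinear_matrix_vector_mult]) auto
    moreover have "\<forall>\<^sub>F s in nhds 0. (t (z s) (y2 s) \<bullet> (a (z s) *v E (z s))) / F x y powr H = \<kappa> s"
      using evD by eventually_elim (simp add: \<kappa>_def bt_form_eq[OF D_U])
    ultimately show ?thesis using isCont_cong by fastforce
  qed
  then have k_lim: "(\<kappa> \<longlongrightarrow> \<kappa> 0) (nhds 0)"
    by (rule isCont_tendsto_nhds)
  have "\<forall>\<^sub>F s in nhds 0. \<kappa> s = \<kappa> 0"
  proof (cases "\<kappa> 0 = 0")
    case True
    show ?thesis using evD evQ by eventually_elim (use kp_sq True in auto)
  next
    case False
    have "((\<lambda>s. \<kappa> s * \<kappa> 0) \<longlongrightarrow> \<kappa> 0 * \<kappa> 0) (nhds 0)"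
      by (intro tendsto_intros k_lim)
    then have "\<forall>\<^sub>F s in nhds 0. \<kappa> s * \<kappa> 0 > 0"
      by (rule order_tendstoD(1)) (metis False not_real_square_gt_zero)
    then show ?thesis using evD evQ
    proof eventually_elim
      case (elim s)
      then have "\<kappa> s = \<kappa> 0 \<or> \<kappa> s = - \<kappa> 0" using kp_sq[of s] by (simp add: power2_eq_iff)
      moreover have "\<not> - \<kappa> 0 * \<kappa> 0 > 0" by (simp add: not_less)
      ultimately show ?case using elim(1) by auto
    qed
  qed
  then have ev: "\<forall>\<^sub>F s in nhds 0. (F x y powr H) *\<^sub>R (sg x (rh x y) *\<^sub>R I s + kp x (rh x y) *\<^sub>R E (z s)) =
      t (z s) (y2 s)"
    using evD evQ
    by eventually_elim (simp add: t_frame F sg kp[symmetric] frame kp0)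
  have "((\<lambda>s. (F x y powr H) *\<^sub>R (sg x (rh x y) *\<^sub>R I s + kp x (rh x y) *\<^sub>R E (z s)))
      has_vector_derivative (F x y powr H) *\<^sub>R (sg x (rh x y) *\<^sub>R ((1 / r) *\<^sub>R (w - \<beta> *\<^sub>R E')) +
        kp x (rh x y) *\<^sub>R E')) (at 0)"
    using I' E' by (intro has_vector_derivative_scaleR_right has_vector_derivative_add)
      (simp_all add: z_def)
  then have "((\<lambda>s. t (z s) (y2 s)) has_vector_derivative (F x y powr H) *\<^sub>R
      (sg x (rh x y) *\<^sub>R ((1 / r) *\<^sub>R (w - \<beta> *\<^sub>R E')) + kp x (rh x y) *\<^sub>R E')) (at 0)"
    using ev by (rule has_vector_derivative_transform_eventually)
  from vector_derivative_unique_at[OF t_path_derivative[OF D z' z0 y2' y20] this]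
  show ?thesis by (simp add: r_def \<beta>_def)
qed

section \<open>The differential of t along y and along I\<close>

lemma Dt_radial:
  assumes D: "(x, y) \<in> D"
  shows "Dt x y (0, y) = H *\<^sub>R t x y"
proof -
  have "((\<lambda>s. y + s *\<^sub>R y) has_vector_derivative y) (at 0)"
    by (rule line_derivative)
  from t_path_derivative[OF D has_vector_derivative_const refl this]
  have "((\<lambda>s. t x ((1 + s) *\<^sub>R y)) has_vector_derivative Dt x y (0, y)) (at 0)"
    by (simp add: algebra_simps)
  moreover have "((\<lambda>s. t x ((1 + s) *\<^sub>R y)) has_vector_derivative H *\<^sub>R t x y) (at 0)"
  proof (rule has_vector_derivative_transform_within_open)
    have "((\<lambda>s. (1 + s) powr H) has_real_derivative H) (at 0)"
      by (auto intro!: derivative_eq_intros)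
    from has_vector_derivative_scaleR[OF this has_vector_derivative_const]
    show "((\<lambda>s. ((1 + s) powr H) *\<^sub>R t x y) has_vector_derivative H *\<^sub>R t x y) (at 0)"
      by simp
    show "((1 + s) powr H) *\<^sub>R t x y = t x ((1 + s) *\<^sub>R y)" if "s \<in> {-1<..}" for s
      using conf D that H_eq[OF D_U[OF D]] unfolding conformal_automorphism_def by fastforce
  qed auto
  ultimately show ?thesis by (rule vector_derivative_unique_at)
qed

text \<open>Moving along I changes only the radius \<open>qt\<close>, so \<open>wt\<close> becomes
  an affine parameter. The bound on s keeps the radius positive; beyond it I would flip.\<close>

lemma i_shift:
  assumes D: "(x, y) \<in> D" and s: "s > - qt_fun a b x y"
  shows "b_form b x (y + s *\<^sub>R i_vec a b x y) = b_form b x y"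
    and "i_vec a b x (y + s *\<^sub>R i_vec a b x y) = i_vec a b x y"
    and "wt_fun a b x (y + s *\<^sub>R i_vec a b x y) = wt_fun a b x y + s / b_form b x y"
proof -
  note x = D_U[OF D]
  have "y + s *\<^sub>R i_vec a b x y = bt_form a b x y *\<^sub>R E x + (qt_fun a b x y + s) *\<^sub>R i_vec a b x y"
    by (subst (1) frame_decomp[OF x qt_pos[OF D]]) (simp add: algebra_simps)
  moreover have "qt_fun a b x y + s > 0" using s by simp
  note frame_coords[OF x i_vec_unit[OF x qt_pos[OF D]] i_vec_orth[OF x] this, of "bt_form a b x y"]
  ultimately show "b_form b x (y + s *\<^sub>R i_vec a b x y) = b_form b x y"
    "i_vec a b x (y + s *\<^sub>R i_vec a b x y) = i_vec a b x y"
    "wt_fun a b x (y + s *\<^sub>R i_vec a b x y) = wt_fun a b x y + s / b_form b x y"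
    by (simp_all add: b_form_eq[OF x] wt_fun_def add_divide_distrib)
qed

lemma eventually_i_shift:
  assumes D: "(x, y) \<in> D"
  shows "\<forall>\<^sub>F s in nhds 0. s > - qt_fun a b x y \<and> (x, y + s *\<^sub>R i_vec a b x y) \<in> D"
proof -
  have "\<forall>\<^sub>F s in nhds 0. s \<in> {- qt_fun a b x y<..}"
    using qt_pos[OF D] by (intro eventually_nhds_in_open) auto
  moreover have "\<forall>\<^sub>F s in nhds 0. (x, y + s *\<^sub>R i_vec a b x y) \<in> D"
    using eventually_D[OF D has_vector_derivative_const refl line_derivative] by simp
  ultimately show ?thesis by eventually_elim simp
qed

text \<open>Along I the quotient F / b is V of a shifted argument, so V inherits differentiability
  from F. The factor r = b in the path makes \<open>wt\<close> run with unit speed.\<close>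

lemma V_has_derivative:
  assumes D: "(x, y) \<in> D"
  shows "(V has_real_derivative deriv V (wt_fun a b x y)) (at (wt_fun a b x y))"
proof -
  define r where "r = b_form b x y"
  define p where "p s = y + (s * r) *\<^sub>R i_vec a b x y" for s
  have r: "r > 0" using dom_pos[OF D] by (simp add: r_def)
  have p': "(p has_vector_derivative r *\<^sub>R i_vec a b x y) (at 0)"
    unfolding p_def by (auto intro!: derivative_eq_intros)
  have p0: "p 0 = y" by (simp add: p_def)
  obtain F' where "((\<lambda>(x, y). F x y) has_derivative F') (at (x, y))"
    using F_differentiable[OF D] unfolding differentiable_def by blast
  then have "((\<lambda>s. F x (p s)) has_vector_derivative F' (0, r *\<^sub>R i_vec a b x y)) (at 0)"
    using has_vector_derivative_comp_path[of "\<lambda>(x, y). F x y" F' "\<lambda>s. (x, p s)" 0]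
      has_vector_derivative_Pair[OF has_vector_derivative_const[of x] p'] p0 by simp
  then have "((\<lambda>s. F x (p s) / r) has_vector_derivative F' (0, r *\<^sub>R i_vec a b x y) / r) (at 0)"
    unfolding has_real_derivative_iff_has_vector_derivative[symmetric]
    by (rule DERIV_cdivide)
  moreover have "\<forall>\<^sub>F s in nhds 0. F x (p s) / r = V (s + wt_fun a b x y)"
  proof -
    have "\<forall>\<^sub>F s in nhds 0. (x, p s) \<in> D"
      by (rule eventually_D[OF D has_vector_derivative_const refl p' p0])
    moreover have "\<forall>\<^sub>F s in nhds 0. s \<in> {- (qt_fun a b x y / r)<..}"
      using qt_pos[OF D] r by (intro eventually_nhds_in_open) auto
    ultimately show ?thesis
    proof eventually_elim
      case (elim s)
      then have "- (qt_fun a b x y / r) * r < s * r"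
        using r by (intro mult_strict_right_mono) simp_all
      then have "s * r > - qt_fun a b x y" using r by simp
      from i_shift[OF D this] elim(1) r show ?case
        by (simp add: p_def F_eq r_def[symmetric] add.commute)
    qed
  qed
  ultimately have "((\<lambda>s. V (s + wt_fun a b x y)) has_vector_derivative F' (0, r *\<^sub>R i_vec a b x y) / r) (at 0)"
    by (rule has_vector_derivative_transform_eventually)
  then have "(V has_real_derivative F' (0, r *\<^sub>R i_vec a b x y) / r) (at (0 + wt_fun a b x y))"
    unfolding has_real_derivative_iff_has_vector_derivative[symmetric]
    by (simp only: DERIV_shift)
  then show ?thesis by (metis DERIV_imp_deriv add_0)
qed

text \<open>With \<open>kp_deriv\<close> this says that the unit vector (sg, kp) turns with angular
  speed H / M as r grows.\<close>

lemma sg_deriv: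
  assumes x: "x \<in> U"
  shows "(sg x has_real_derivative kp x r * (H / M x r)) (at r)"
proof -
  have "(sg x has_real_derivative (H * cos r * M x r - H * sin r * (C1 x * - sin r)) / (M x r * M x r)) (at r)"
    unfolding sg_def M_def using M_pos[OF x, of r]
    by (auto intro!: derivative_eq_intros simp: M_def)
  \<comment> \<open>Adding a multiple of sin^2 + cos^2 - 1, which is zero, makes the equation a
    purely polynomial identity.\<close>
  moreover have "H * cos r * M x r - H * sin r * (C1 x * - sin r) =
      (C1 x + C x * cos r) * H + C1 x * H * ((sin r)\<^sup>2 + (cos r)\<^sup>2 - 1)"
    unfolding M_def by (simp only: power2_eq_square) (simp only: algebra_simps)
  ultimately show ?thesis by (simp add: kp_def)
qed

lemma kp_deriv:
  assumes x: "x \<in> U"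
  shows "(kp x has_real_derivative - sg x r * (H / M x r)) (at r)"
proof -
  have "(kp x has_real_derivative
      (C x * - sin r * M x r - (C1 x + C x * cos r) * (C1 x * - sin r)) / (M x r * M x r)) (at r)"
    unfolding kp_def M_def using M_pos[OF x, of r]
    by (auto intro!: derivative_eq_intros simp: M_def)
  moreover have "C x * - sin r * M x r - (C1 x + C x * cos r) * (C1 x * - sin r) = - (H\<^sup>2 * sin r)"
    unfolding M_def H_sq[OF x] by (simp add: power2_eq_square algebra_simps)
  ultimately show ?thesis by (simp add: sg_def power2_eq_square mult_ac)
qed

text \<open>Along I the vector t = F^H (sg I + kp E) stays in the plane of the fixed vectors I and
  E. The first term is its stretching, from the logarithmic derivative of F, and the second its
  turning.\<close>

lemma Dt_i:
  fixes x y
  defines "wt \<equiv> wt_fun a b x y" and "\<sigma> \<equiv> sg x (rh x y)" and "\<kappa> \<equiv> kp x (rh x y)" and "I \<equiv> i_vec a b x y"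
  assumes D: "(x, y) \<in> D"
  shows "Dt x y (0, I) = (F x y powr H / b_form b x y) *\<^sub>R
    ((H * deriv V wt / V wt) *\<^sub>R (\<sigma> *\<^sub>R I + \<kappa> *\<^sub>R E x) +
     (H * sqrt (rad_tau V wt) / tau_fun V wt) *\<^sub>R (\<kappa> *\<^sub>R I - \<sigma> *\<^sub>R E x))"
proof -
  note x = D_U[OF D]
  define \<beta> where "\<beta> = b_form b x y"
  define R where "R = sqrt (rad_tau V wt) / tau_fun V wt"
  define P where "P s = (\<beta> * V (wt + s / \<beta>)) powr H" for s
  define r where "r s = \<rho> x (w_of_wt a b x (wt + s / \<beta>))" for s
  have \<beta>: "\<beta> > 0" using dom_pos[OF D] by (simp add: \<beta>_def)
  have Vp: "V wt > 0" using V_pos[OF D] by (simp add: wt_def)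
  have F: "F x y = \<beta> * V wt" by (simp add: F_eq[OF D] \<beta>_def wt_def)
  have r0: "r 0 = rh x y"
    using w_of_wt_eq[OF x _ refl, of y] \<beta> by (simp add: r_def rh_def wt_def \<beta>_def)
  have lin: "((\<lambda>s. wt + s / \<beta>) has_real_derivative 1 / \<beta>) (at 0)"
    using \<beta> by (auto intro!: derivative_eq_intros)
  have V': "((\<lambda>s. V (wt + s / \<beta>)) has_real_derivative deriv V wt * (1 / \<beta>)) (at 0)"
    using DERIV_chain'[OF lin, of V "deriv V wt"] V_has_derivative[OF D] by (simp add: wt_def)
  have "(P has_real_derivative H * (\<beta> * V wt) powr (H - 1) * deriv V wt) (at 0)"
    unfolding P_def using \<beta> Vp by (auto intro!: derivative_eq_intros V' simp: mult_ac)
  moreover have "(\<beta> * V wt) powr (H - 1) = F x y powr H / (\<beta> * V wt)"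
    using \<beta> Vp by (simp add: F powr_diff)
  ultimately have P': "(P has_real_derivative F x y powr H / \<beta> * (H * deriv V wt / V wt)) (at 0)"
    by (simp add: mult_ac)
  have r': "(r has_real_derivative 1 / wt * sqrt (rad_tau V wt / tau_fun V wt) * sin (rh x y) * (1 / \<beta>)) (at 0)"
    unfolding r_def
  proof (rule DERIV_chain'[OF lin])
    show "((\<lambda>s. \<rho> x (w_of_wt a b x s)) has_real_derivative
        1 / wt * sqrt (rad_tau V wt / tau_fun V wt) * sin (rh x y)) (at (wt + 0 / \<beta>))"
      using rho_deriv[OF D] by (simp add: wt_def rh_def)
  qed
  \<comment> \<open>The factor H sin rho / M is \<open>sg\<close>, which \<open>sg_eq\<close>
    replaces by H wt / sqrt tau. The turning speed is thereby free of C, C1 and rho.\<close>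
  have rate: "H / M x (rh x y) * (1 / wt * sqrt (rad_tau V wt / tau_fun V wt) * sin (rh x y) * (1 / \<beta>)) = H * R / \<beta>"
  proof -
    have "H / M x (rh x y) * (1 / wt * sqrt (rad_tau V wt / tau_fun V wt) * sin (rh x y) * (1 / \<beta>)) =
        \<sigma> * (1 / wt) * (sqrt (rad_tau V wt) / sqrt (tau_fun V wt)) / \<beta>"
      by (simp add: \<sigma>_def sg_def real_sqrt_divide mult_ac)
    also have "\<dots> = H * (sqrt (rad_tau V wt) / (sqrt (tau_fun V wt) * sqrt (tau_fun V wt))) / \<beta>"
      using wt_pos[OF D] by (simp add: \<sigma>_def sg_eq[OF D] wt_def[symmetric])
    also have "\<dots> = H * R / \<beta>"
      using tau_pos[OF D] by (simp add: R_def wt_def)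
    finally show ?thesis .
  qed
  have sg': "((\<lambda>s. sg x (r s)) has_real_derivative \<kappa> * (H * R / \<beta>)) (at 0)"
    using DERIV_chain'[OF r' sg_deriv[OF x]] by (simp add: r0 \<kappa>_def rate[symmetric] mult_ac)
  have kp': "((\<lambda>s. kp x (r s)) has_real_derivative - \<sigma> * (H * R / \<beta>)) (at 0)"
    using DERIV_chain'[OF r' kp_deriv[OF x]] by (simp add: r0 \<sigma>_def rate[symmetric] mult_ac)
  have I: "((\<lambda>s. c s *\<^sub>R v) has_vector_derivative c' *\<^sub>R v) (at 0)"
    if "(c has_real_derivative c') (at 0)" for c c' and v :: "real ^ 'n"
    using has_vector_derivative_scaleR[OF that has_vector_derivative_const] by simp
  have "((\<lambda>s. P s *\<^sub>R (sg x (r s) *\<^sub>R I + kp x (r s) *\<^sub>R E x)) has_vector_derivative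
      P 0 *\<^sub>R ((\<kappa> * (H * R / \<beta>)) *\<^sub>R I + (- \<sigma> * (H * R / \<beta>)) *\<^sub>R E x) +
      (F x y powr H / \<beta> * (H * deriv V wt / V wt)) *\<^sub>R (sg x (r 0) *\<^sub>R I + kp x (r 0) *\<^sub>R E x)) (at 0)"
    by (intro has_vector_derivative_scaleR has_vector_derivative_add I P' sg' kp')
  moreover have "\<forall>\<^sub>F s in nhds 0. P s *\<^sub>R (sg x (r s) *\<^sub>R I + kp x (r s) *\<^sub>R E x) = t x (y + s *\<^sub>R I)"
    using eventually_i_shift[OF D]
  proof eventually_elim
    case (elim s)
    then have Ds: "(x, y + s *\<^sub>R I) \<in> D" and s: "s > - qt_fun a b x y" by (simp_all add: I_def)
    note sh = i_shift[OF D s, folded I_def wt_def \<beta>_def]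
    have "r s = rh x (y + s *\<^sub>R I)"
      using w_of_wt_eq[OF x _ sh(3)] \<beta> by (simp add: r_def rh_def sh(1))
    then show ?case
      by (simp add: t_frame[OF Ds] F_eq[OF Ds] sh P_def)
  qed
  ultimately have "((\<lambda>s. t x (y + s *\<^sub>R I)) has_vector_derivative
      P 0 *\<^sub>R ((\<kappa> * (H * R / \<beta>)) *\<^sub>R I + (- \<sigma> * (H * R / \<beta>)) *\<^sub>R E x) +
      (F x y powr H / \<beta> * (H * deriv V wt / V wt)) *\<^sub>R (sg x (r 0) *\<^sub>R I + kp x (r 0) *\<^sub>R E x)) (at 0)"
    by (rule has_vector_derivative_transform_eventually)
  moreover have "((\<lambda>s. t x (y + s *\<^sub>R I)) has_vector_derivative Dt x y (0, I)) (at 0)"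
    by (rule t_path_derivative[OF D has_vector_derivative_const refl line_derivative]) simp
  ultimately have "Dt x y (0, I) =
      P 0 *\<^sub>R ((\<kappa> * (H * R / \<beta>)) *\<^sub>R I + (- \<sigma> * (H * R / \<beta>)) *\<^sub>R E x) +
      (F x y powr H / \<beta> * (H * deriv V wt / V wt)) *\<^sub>R (sg x (r 0) *\<^sub>R I + kp x (r 0) *\<^sub>R E x)"
    by (metis vector_derivative_unique_at)
  moreover have "P 0 = F x y powr H" by (simp add: P_def F)
  ultimately show ?thesis
    by (simp add: r0 \<sigma>_def[symmetric] \<kappa>_def[symmetric] \<beta>_def[symmetric] R_def algebra_simps)
qed

section \<open>Injectivity of the Jacobian and differentiability of the inverse\<close>

lemma t_has_derivative_y:
  assumes D: "(x, y) \<in> D"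
  shows "(t x has_derivative (\<lambda>v. Dt x y (0, v))) (at y)"
proof -
  have "((\<lambda>z. (x, z)) has_derivative (\<lambda>v. (0, v))) (at y)"
    by (rule has_derivative_Pair[OF has_derivative_const has_derivative_ident])
  from has_derivative_compose[OF this t_has_derivative[OF D]] show ?thesis by simp
qed

lemma t_has_derivative_x:
  assumes D: "(x, y) \<in> D"
  shows "((\<lambda>z. t z y) has_derivative (\<lambda>e. Dt x y (e, 0))) (at x)"
proof -
  have "((\<lambda>z. (z, y)) has_derivative (\<lambda>e. (e, 0))) (at x)"
    by (rule has_derivative_Pair[OF has_derivative_ident has_derivative_const])
  from has_derivative_compose[OF this t_has_derivative[OF D]] show ?thesis by simp
qed

text \<open>The Finsler tensor is a multiple of the pullback of \<open>a\<close> under J. A kernel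
  vector of J would therefore be null for it, against positive definiteness.\<close>

lemma Dt_injective:
  assumes D: "(x, y) \<in> D" and 0: "Dt x y (0, v) = 0"
  shows "v = 0"
proof (rule ccontr)
  assume v: "v \<noteq> 0"
  define T where "T n j = Dt x y (0, axis n 1) $ j" for n j
  have "linear (\<lambda>v. Dt x y (0, v))"
    using t_has_derivative_y[OF D] has_derivative_linear by blast
  from linear_nth_sum[OF this, of v] 0 have T0: "(\<Sum>n\<in>UNIV. T n j * v $ n) = 0" for j
    by (simp add: T_def)
  have pd: "partial_deriv n (\<lambda>z. t x z $ j) y = T n j" for n j
    unfolding T_def
    by (rule partial_deriv_eq[OF bounded_linear.has_derivative[OF bounded_linear_vec_nth t_has_derivative_y[OF D]]])
  obtain p where g: "\<And>k n. finsler_tensor F x y k n =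
      p * (\<Sum>i\<in>UNIV. \<Sum>j\<in>UNIV. a x $ i $ j * T k i * T n j)"
    using conf D unfolding conformal_automorphism_def pd[symmetric] by blast
  have "(\<Sum>n\<in>UNIV. finsler_tensor F x y k n * v $ k * v $ n) = 0" for k
  proof -
    have "(\<Sum>n\<in>UNIV. finsler_tensor F x y k n * v $ k * v $ n) =
        (\<Sum>n\<in>UNIV. \<Sum>i\<in>UNIV. \<Sum>j\<in>UNIV. p * v $ k * a x $ i $ j * T k i * (T n j * v $ n))"
      unfolding g by (simp add: sum_distrib_left sum_distrib_right mult_ac)
    also have "\<dots> = (\<Sum>i\<in>UNIV. \<Sum>n\<in>UNIV. \<Sum>j\<in>UNIV. p * v $ k * a x $ i $ j * T k i * (T n j * v $ n))"
      by (rule sum.swap)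
    also have "\<dots> = (\<Sum>i\<in>UNIV. \<Sum>j\<in>UNIV. \<Sum>n\<in>UNIV. p * v $ k * a x $ i $ j * T k i * (T n j * v $ n))"
      by (intro sum.cong refl sum.swap)
    also have "\<dots> = 0" by (simp add: sum_distrib_left[symmetric] T0)
    finally show ?thesis .
  qed
  then have "(\<Sum>k\<in>UNIV. \<Sum>n\<in>UNIV. finsler_tensor F x y k n * v $ k * v $ n) = 0"
    by simp
  moreover have "(\<Sum>k\<in>UNIV. \<Sum>n\<in>UNIV. finsler_tensor F x y k n * v $ k * v $ n) > 0"
    using finsler D v unfolding finsler_metric_on_def by blast
  ultimately show False by simp
qed

section \<open>The coefficients\<close>

text \<open>A local inverse is given only as a homeomorphism. Its derivative comes from the inverse
  function rule: J is injective, so it has a linear left inverse, and Y is continuous.\<close>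

lemma Y_has_derivative:
  assumes D: "(x, y) \<in> D" and Y: "local_inverse_at (t x) Y y"
  obtains Y' where "(Y has_derivative Y') (at (t x y))" "\<And>v. Y' (Dt x y (0, v)) = v"
proof -
  have lin: "linear (\<lambda>v. Dt x y (0, v))"
    using t_has_derivative_y[OF D] has_derivative_linear by blast
  have "inj (\<lambda>v. Dt x y (0, v))"
    using Dt_injective[OF D] by (simp add: linear_injective_0[OF lin])
  then obtain Y' where Y': "linear Y'" "Y' \<circ> (\<lambda>v. Dt x y (0, v)) = id"
    using linear_injective_left_inverse[OF lin] by blast
  obtain W where W: "open W" "y \<in> W" "open (t x ` W)" "homeomorphism W (t x ` W) (t x) Y"
    using Y unfolding local_inverse_at_def by blast
  have "(Y has_derivative Y') (at (t x y))"
  proof (rule has_derivative_inverse_basic[OF _ _ Y'(2) _ W(3)])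
    have "Y (t x y) = y" using W by (simp add: homeomorphism_apply1)
    then show "(t x has_derivative (\<lambda>v. Dt x y (0, v))) (at (Y (t x y)))"
      using t_has_derivative_y[OF D] by simp
    show "bounded_linear Y'" using Y'(1) by (simp add: linear_conv_bounded_linear)
    show "continuous (at (t x y)) Y"
      using W by (meson continuous_on_eq_continuous_at homeomorphism_cont2 imageI)
    show "t x (Y z) = z" if "z \<in> t x ` W" for z
      using W(4) that by (simp add: homeomorphism_apply2)
  qed (use W in simp)
  moreover have "Y' (Dt x y (0, v)) = v" for v
    using fun_cong[OF Y'(2), of v] by simp
  ultimately show ?thesis by (rule that)
qed

text \<open>If it vanished, t would not turn along I, so J I and J y would both be multiples of t.
  Injectivity would make y a multiple of I, contradicting bt > 0.\<close>

lemma rad_tau_nonzero: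
  assumes D: "(x, y) \<in> D"
  shows "rad_tau V (wt_fun a b x y) \<noteq> 0"
proof
  assume 0: "rad_tau V (wt_fun a b x y) = 0"
  note x = D_U[OF D]
  \<comment> \<open>The factor F / V' equates the stretching along k I with the radial one, H
    t.\<close>
  define k where "k = b_form b x y * V (wt_fun a b x y) / deriv V (wt_fun a b x y)"
  have V: "deriv V (wt_fun a b x y) \<noteq> 0" "V (wt_fun a b x y) > 0" "b_form b x y > 0"
    using tau_pos[OF D] V_pos[OF D] dom_pos[OF D] by (auto simp: tau_fun_def)
  have "Dt x y (0, y) = k *\<^sub>R Dt x y (0, i_vec a b x y)"
    unfolding Dt_radial[OF D] Dt_i[OF D] 0 t_frame[OF D] using V
    by (simp add: k_def)
  then have "Dt x y (0, y - k *\<^sub>R i_vec a b x y) = 0"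
    using linear_diff[OF linear_Dt[OF D], of "(0, y)" "(0, k *\<^sub>R i_vec a b x y)"]
      linear_scale[OF linear_Dt[OF D], of k "(0, i_vec a b x y)"] by simp
  then have "y = k *\<^sub>R i_vec a b x y"
    using Dt_injective[OF D] by fastforce
  then have "bt_form a b x y = 0"
    using i_vec_orth[OF x, of y] by (metis bt_form_eq[OF x] inner_scaleR_left mult_zero_right)
  then show False using bt_pos[OF D] by simp
qed

text \<open>The radicand equals b^2 tau kp^2, so the root with the sign of b^* is b sqrt(tau) kp.
  Multiplying by sg = H wt / sqrt tau removes tau; for kp = 0 both sides vanish.\<close>

lemma B_minus_sq:
  assumes D: "(x, y) \<in> D"
  shows "sgn (bt_form a b x (t x y)) * sqrt (B_fun a b V x y - H\<^sup>2 * (qt_fun a b x y)\<^sup>2) *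
    sg x (rh x y) = H * qt_fun a b x y * kp x (rh x y)"
proof -
  define w where "w = wt_fun a b x y"
  define T where "T = tau_fun V w"
  have T: "T > 0" using tau_pos[OF D] by (simp add: T_def w_def)
  have b: "b_form b x y > 0" using dom_pos[OF D] by blast
  have sg: "sg x (rh x y) = H * w / sqrt T" by (simp add: sg_eq[OF D] T_def w_def)
  have q: "qt_fun a b x y = b_form b x y * w" using b by (simp add: w_def wt_fun_def)
  have kp: "T * (kp x (rh x y))\<^sup>2 = T - H\<^sup>2 * w\<^sup>2"
    using sg_kp[OF D_U[OF D], of "rh x y"] T unfolding sg power_divide
    by (simp add: field_simps)
  have "B_fun a b V x y - H\<^sup>2 * (qt_fun a b x y)\<^sup>2 = (b_form b x y)\<^sup>2 * (T - H\<^sup>2 * w\<^sup>2)"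
    by (simp add: B_fun_def q w_def[symmetric] T_def[symmetric] power_mult_distrib algebra_simps)
  also have "\<dots> = (b_form b x y)\<^sup>2 * T * (kp x (rh x y))\<^sup>2"
    by (simp only: kp[symmetric] mult.assoc)
  finally have "B_fun a b V x y - H\<^sup>2 * (qt_fun a b x y)\<^sup>2 = (b_form b x y)\<^sup>2 * T * (kp x (rh x y))\<^sup>2" .
  then have "sqrt (B_fun a b V x y - H\<^sup>2 * (qt_fun a b x y)\<^sup>2) = b_form b x y * sqrt T * \<bar>kp x (rh x y)\<bar>"
    using b by (simp add: real_sqrt_mult)
  moreover have "sgn (bt_form a b x (t x y)) = sgn (kp x (rh x y))"
    using F_pos[OF D] by (simp add: bt_form_t[OF D] sgn_mult)
  ultimately have "sgn (bt_form a b x (t x y)) * sqrt (B_fun a b V x y - H\<^sup>2 * (qt_fun a b x y)\<^sup>2) =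
      b_form b x y * sqrt T * kp x (rh x y)"
    by (simp add: sgn_if abs_if)
  then show ?thesis using T by (simp add: sg q)
qed

text \<open>The vector is (wt / sqrt rad) (y - k I) with k = b tau / wt. This k makes the stretching
  parts of J y and k J I cancel, leaving pure turning, and the prefactor normalizes the turning rate
  to H.\<close>

lemma Dt_F_alpha:
  assumes D: "(x, y) \<in> D"
  shows "Dt x y (0, \<chi> m. F_alpha a b V x y m) =
    - (H * F x y powr H) *\<^sub>R (kp x (rh x y) *\<^sub>R i_vec a b x y - sg x (rh x y) *\<^sub>R E x)"
proof -
  note x = D_U[OF D]
  define w where "w = wt_fun a b x y"
  define T where "T = tau_fun V w"
  define R where "R = sqrt (rad_tau V w)"
  define \<beta> where "\<beta> = b_form b x y"
  define I where "I = i_vec a b x y"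
  define u where "u = sg x (rh x y) *\<^sub>R I + kp x (rh x y) *\<^sub>R E x"
  define u' where "u' = kp x (rh x y) *\<^sub>R I - sg x (rh x y) *\<^sub>R E x"
  define k where "k = \<beta> * T / w"
  have pos: "T > 0" "w > 0" "\<beta> > 0" "R \<noteq> 0" "qt_fun a b x y > 0"
    using tau_pos[OF D] wt_pos[OF D] dom_pos[OF D] rad_tau_nonzero[OF D]
    by (simp_all add: T_def w_def \<beta>_def R_def)
  have q: "qt_fun a b x y = \<beta> * w" using pos by (simp add: w_def \<beta>_def wt_fun_def)
  have V: "deriv V w \<noteq> 0" "V w > 0" and T: "T = w * V w / deriv V w"
    using pos(1) V_pos[OF D] by (auto simp: T_def tau_fun_def w_def)
  have "y - bt_form a b x y *\<^sub>R E x = qt_fun a b x y *\<^sub>R I"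
    using pos by (simp add: I_def i_vec_eq[OF x])
  then have "y $ m - bt_form a b x y * E x $ m = qt_fun a b x y * I $ m" for m
    by (metis vector_minus_component vector_scaleR_component real_scaleR_def)
  then have Fa: "(\<chi> m. F_alpha a b V x y m) = (w / R) *\<^sub>R (y - k *\<^sub>R I)"
    using pos by (simp add: vec_eq_iff F_alpha_def B_fun_def w_def[symmetric] T_def[symmetric]
        R_def[symmetric] \<beta>_def[symmetric] q k_def power2_eq_square)
  have "Dt x y (0, (w / R) *\<^sub>R (y - k *\<^sub>R I)) = (w / R) *\<^sub>R (Dt x y (0, y) - k *\<^sub>R Dt x y (0, I))"
    using linear_diff[OF linear_Dt[OF D], of "(0, y)" "(0, k *\<^sub>R I)"]
      linear_scale[OF linear_Dt[OF D], of k "(0, I)"]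
      linear_scale[OF linear_Dt[OF D], of "w / R" "(0, y - k *\<^sub>R I)"] by simp
  also have "Dt x y (0, y) = (H * F x y powr H) *\<^sub>R u"
    by (simp add: Dt_radial[OF D] t_frame[OF D] u_def I_def)
  also have "k *\<^sub>R Dt x y (0, I) = (H * F x y powr H) *\<^sub>R u + (H * F x y powr H * R / w) *\<^sub>R u'"
  proof -
    have "Dt x y (0, I) = (F x y powr H / \<beta>) *\<^sub>R ((H * deriv V w / V w) *\<^sub>R u + (H * R / T) *\<^sub>R u')"
      unfolding I_def u_def u'_def R_def T_def \<beta>_def w_def by (rule Dt_i[OF D])
    then have "k *\<^sub>R Dt x y (0, I) = (k * (F x y powr H / \<beta>) * (H * deriv V w / V w)) *\<^sub>R u +
        (k * (F x y powr H / \<beta>) * (H * R / T)) *\<^sub>R u'"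
      by (simp only: scaleR_add_right scaleR_scaleR mult.assoc)
    moreover have "k * (F x y powr H / \<beta>) * (H * deriv V w / V w) = H * F x y powr H"
      using pos V unfolding k_def T by simp
    moreover have "k * (F x y powr H / \<beta>) * (H * R / T) = H * F x y powr H * R / w"
      using pos unfolding k_def by simp
    ultimately show ?thesis by (simp only:)
  qed
  finally show ?thesis
    unfolding Fa using pos by (simp add: u'_def I_def)
qed

lemma N_coeff_formula:
  assumes D: "(x, y) \<in> D" and Y: "local_inverse_at (t x) (Y x) y"
  shows "N_coeff a t Y x y m i =
      1 / H * (1 / qt_fun a b x y) * y_nabla_bt a b x y i * F_alpha a b V x y m
      - 1 / H * (sgn (bt_form a b x (t x y)) * sqrt (B_fun a b V x y - H\<^sup>2 * (qt_fun a b x y)\<^sup>2)) *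
          beta_t a b x y m i
      - y_nabla_bt a b x y i * E x $ m
      + bt_form a b x y * nabla_vec a E x i m
      - (\<Sum>h\<in>UNIV. christoffel a x m i h * y $ h)"
proof -
  note x = D_U[OF D]
  define e where "e = (axis i 1 :: real ^ 'n)"
  define G where "G = christoffel_mat a x i"
  define \<beta> where "\<beta> = bt_form a b x y"
  define q where "q = qt_fun a b x y"
  define I where "I = i_vec a b x y"
  define \<sigma> where "\<sigma> = sg x (rh x y)"
  define \<kappa> where "\<kappa> = kp x (rh x y)"
  define P where "P = F x y powr H"
  define X where "X = sgn (bt_form a b x (t x y)) * sqrt (B_fun a b V x y - H\<^sup>2 * (qt_fun a b x y)\<^sup>2)"
  define \<phi> where "\<phi> = (\<chi> m. F_alpha a b V x y m)"
  obtain E' where E': "(E has_derivative E') (at x)"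
    using E_differentiable[OF x] unfolding differentiable_def by blast
  define \<nu> where "\<nu> = E' e + G *v E x"
  define \<eta> where "\<eta> = y_nabla_bt a b x y i"
  have q: "q > 0" using qt_pos[OF D] by (simp add: q_def)
  have y: "y = \<beta> *\<^sub>R E x + q *\<^sub>R I"
    unfolding \<beta>_def q_def I_def by (rule frame_decomp[OF x qt_pos[OF D]])
  have t: "t x y = P *\<^sub>R (\<sigma> *\<^sub>R I + \<kappa> *\<^sub>R E x)"
    by (simp add: t_frame[OF D] P_def \<sigma>_def \<kappa>_def I_def)
  have nabla_E: "nabla_vec a E x i m = \<nu> $ m" for m
    by (simp add: nabla_vec_eq[OF E'] \<nu>_def e_def G_def)
  have \<nu>E: "E x \<bullet> (a x *v \<nu>) = 0"
    unfolding \<nu>_def e_def G_def by (rule unit_field_nabla_orthogonal[OF x E' E_unit])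
  have \<eta>: "\<eta> = y \<bullet> (a x *v \<nu>)"
    unfolding \<eta>_def y_nabla_bt_def \<nu>_def e_def G_def
    by (simp add: inner_vec_def nabla_covec_lower[where \<omega> = "bt_low a b", OF x E' bt_low_eq])
  have beta_y: "y \<bullet> (a x *v E x) = \<beta>" by (simp add: \<beta>_def bt_form_eq[OF x])
  note comm = a_inner_commute[OF x]
  note lin = matrix_vector_right_distrib matrix_vector_mult_diff_distrib matrix_vector_mult_scaleR
    inner_add_left inner_add_right inner_diff_left inner_diff_right

  \<comment> \<open>This is A y - G y of the overview, with <nu, y> = eta. Both \<open>bt\<close>
    and the length of y are covariantly preserved by it: A is skew and moves E with velocity
    nu.\<close>
  define w where "w = \<beta> *\<^sub>R \<nu> - \<eta> *\<^sub>R E x - G *v y"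
  have w1: "Dt x y (e, w) = P *\<^sub>R ((\<sigma> / q) *\<^sub>R (w - \<beta> *\<^sub>R E' e) + \<kappa> *\<^sub>R E' e)"
    unfolding P_def \<sigma>_def q_def \<beta>_def \<kappa>_def
  proof (rule Dt_isometric[OF D])
    have line: "((\<lambda>s. x + s *\<^sub>R e) has_vector_derivative e) (at 0)"
      "((\<lambda>s. y + s *\<^sub>R w) has_vector_derivative w) (at 0)" by (rule line_derivative)+
    have a': "((\<lambda>s. a (x + s *\<^sub>R e)) has_vector_derivative frechet_derivative a (at x) e) (at 0)"
      by (rule has_vector_derivative_comp_path[OF _ line(1)]) (simp add: a_has_derivative[OF x])
    show Es: "((\<lambda>s. E (x + s *\<^sub>R e)) has_vector_derivative E' e) (at 0)"
      by (rule has_vector_derivative_comp_path[OF _ line(1)]) (simp add: E')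
    have compat: "u \<bullet> (frechet_derivative a (at x) e *v v) = u \<bullet> (a x *v (G *v v)) + v \<bullet> (a x *v (G *v u))"
      for u v unfolding e_def G_def by (rule metric_compatible[OF x])
    have E'e: "E' e = \<nu> - G *v E x" by (simp add: \<nu>_def)
    have "((\<lambda>s. (y + s *\<^sub>R w) \<bullet> (a (x + s *\<^sub>R e) *v E (x + s *\<^sub>R e))) has_real_derivative
        y \<bullet> (a x *v E' e + frechet_derivative a (at x) e *v E x) + w \<bullet> (a x *v E x)) (at 0)"
      using has_vector_derivative_inner[OF line(2) has_vector_derivative_matrix_vector_mult[OF a' Es]]
      by simp
    also have "y \<bullet> (a x *v E' e + frechet_derivative a (at x) e *v E x) + w \<bullet> (a x *v E x) = 0"
      unfolding E'e w_def using comm[of "E x" "G *v y"] comm[of "E x" \<nu>] \<nu>E E_unit[OF x] \<eta>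
      by (simp add: lin compat)
    finally have d: "((\<lambda>s. (y + s *\<^sub>R w) \<bullet> (a (x + s *\<^sub>R e) *v E (x + s *\<^sub>R e)))
        has_real_derivative 0) (at 0)" .
    have "\<forall>\<^sub>F s in nhds 0. x + s *\<^sub>R e \<in> U"
      using eventually_D[OF D line(1) _ has_vector_derivative_const refl] by (simp add: eventually_mono D_U)
    then have "\<forall>\<^sub>F s in nhds 0. (y + s *\<^sub>R w) \<bullet> (a (x + s *\<^sub>R e) *v E (x + s *\<^sub>R e)) =
        bt_form a b (x + s *\<^sub>R e) (y + s *\<^sub>R w)"
      by eventually_elim (simp add: bt_form_eq)
    with d show "((\<lambda>s. bt_form a b (x + s *\<^sub>R e) (y + s *\<^sub>R w)) has_real_derivative 0) (at 0)"
      unfolding has_real_derivative_iff_has_vector_derivative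
      by (rule has_vector_derivative_transform_eventually)
    have "((\<lambda>s. (y + s *\<^sub>R w) \<bullet> (a (x + s *\<^sub>R e) *v (y + s *\<^sub>R w))) has_real_derivative
        y \<bullet> (a x *v w + frechet_derivative a (at x) e *v y) + w \<bullet> (a x *v y)) (at 0)"
      using has_vector_derivative_inner[OF line(2) has_vector_derivative_matrix_vector_mult[OF a' line(2)]]
      by simp
    also have "y \<bullet> (a x *v w + frechet_derivative a (at x) e *v y) + w \<bullet> (a x *v y) = 0"
      unfolding w_def using comm[of y "G *v y"] comm[of y \<nu>] comm[of y "E x"] beta_y \<eta>
      by (simp add: lin compat)
    finally show "((\<lambda>s. (y + s *\<^sub>R w) \<bullet> (a (x + s *\<^sub>R e) *v (y + s *\<^sub>R w)))
        has_real_derivative 0) (at 0)" .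
  qed
  have w2: "w - \<beta> *\<^sub>R E' e = - (q *\<^sub>R (G *v I)) - \<eta> *\<^sub>R E x"
    unfolding w_def \<nu>_def by (subst y) (simp add: lin algebra_simps)

  \<comment> \<open>Since nu is orthogonal to E, eta = <nu, y> = q <nu, I>. Hence omega is the part
    of nu orthogonal to both E and I; moving y along it is an infinitesimal rotation about E, so
    \<open>Dt_isometric\<close> applies with x at rest.\<close>
  define \<omega> where "\<omega> = \<nu> - (\<eta> / q) *\<^sub>R I"
  have omega1: "Dt x y (0, \<omega>) = P *\<^sub>R (\<sigma> / q) *\<^sub>R \<omega>"
  proof -
    have IE: "I \<bullet> (a x *v E x) = 0" and II: "I \<bullet> (a x *v I) = 1"
      by (simp_all add: I_def i_vec_orth[OF x] i_vec_unit[OF x qt_pos[OF D]])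
    have Iy: "I \<bullet> (a x *v y) = q"
      by (subst y) (simp add: lin IE II)
    have \<omega>E: "\<omega> \<bullet> (a x *v E x) = 0"
      using \<nu>E comm[of "E x" \<nu>] IE by (simp add: \<omega>_def lin)
    have \<omega>y: "\<omega> \<bullet> (a x *v y) = 0"
      using \<eta> comm[of y \<nu>] Iy q by (simp add: \<omega>_def lin)
    have line: "((\<lambda>s. y + s *\<^sub>R \<omega>) has_vector_derivative \<omega>) (at 0)" by (rule line_derivative)
    have a0: "((\<lambda>s. a (x + s *\<^sub>R 0)) has_vector_derivative 0) (at 0)" by simp
    have "Dt x y (0, \<omega>) = (F x y powr H) *\<^sub>R
      ((sg x (rh x y) / qt_fun a b x y) *\<^sub>R (\<omega> - bt_form a b x y *\<^sub>R 0) + kp x (rh x y) *\<^sub>R 0)"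
    proof (rule Dt_isometric[OF D])
      show "((\<lambda>s. E (x + s *\<^sub>R 0)) has_vector_derivative 0) (at 0)" by simp
      show "((\<lambda>s. bt_form a b (x + s *\<^sub>R 0) (y + s *\<^sub>R \<omega>)) has_real_derivative 0) (at 0)"
        using \<omega>E by (simp add: bt_form_eq[OF x] lin)
      show "((\<lambda>s. (y + s *\<^sub>R \<omega>) \<bullet> (a (x + s *\<^sub>R 0) *v (y + s *\<^sub>R \<omega>))) has_real_derivative 0) (at 0)"
        using has_vector_derivative_inner[OF line has_vector_derivative_matrix_vector_mult[OF a0 line]]
          \<omega>y comm[of y \<omega>] by simp
    qed
    then show ?thesis by (simp add: P_def \<sigma>_def q_def)
  qed
  have beta: "beta_t a b x y m i = \<omega> $ m" for m
  proof -
    have "y $ m - \<beta> * E x $ m = q * I $ m"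
      by (subst y) simp
    then show ?thesis
      using q by (simp add: beta_t_def nabla_E \<omega>_def \<eta>_def[symmetric] \<beta>_def[symmetric]
          q_def[symmetric] power2_eq_square)
  qed

  \<comment> \<open>Origin of the coefficients: A t = P kp omega + (P eta / q) (kp I - sg E). By
    \<open>B_minus_sq\<close> the first term is J applied to (X / H) omega, and by
    \<open>Dt_F_alpha\<close> the second is J applied to -(eta / (H q)) phi. So N is w - J^-1 (A t),
    and it is enough to check that J N = -T, where T is the vector contracted with the inverse
    Jacobian in \<open>N_coeff\<close>.\<close>
  define N where "N = (\<eta> / (H * q)) *\<^sub>R \<phi> - (X / H) *\<^sub>R \<omega> + w"
  define T where "T = Dt x y (e, 0) + G *v t x y"
  have "Dt x y (0, N) = (\<eta> / (H * q)) *\<^sub>R Dt x y (0, \<phi>) - (X / H) *\<^sub>R Dt x y (0, \<omega>)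
      + (Dt x y (e, w) - Dt x y (e, 0))"
  proof -
    note L = linear_Dt[OF D]
    have "(0, N) = (\<eta> / (H * q)) *\<^sub>R (0, \<phi>) - (X / H) *\<^sub>R (0, \<omega>) + ((e, w) - (e, 0))"
      by (simp add: N_def)
    then show ?thesis
      by (simp only: linear_add[OF L] linear_diff[OF L] linear_scale[OF L])
  qed
  also have "\<dots> = - T"
  proof -
    have H: "H > 0" by (rule H_pos[OF x])
    have k1: "Dt x y (0, \<phi>) = - (H * P) *\<^sub>R (\<kappa> *\<^sub>R I - \<sigma> *\<^sub>R E x)"
      unfolding \<phi>_def P_def \<kappa>_def I_def \<sigma>_def by (rule Dt_F_alpha[OF D])
    have "X * \<sigma> = H * q * \<kappa>"
      unfolding X_def \<sigma>_def q_def \<kappa>_def by (rule B_minus_sq[OF D])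
    then have "X / H * (P * (\<sigma> / q)) = P * \<kappa>"
      using H q by (simp add: field_simps)
    then have k2: "(X / H) *\<^sub>R Dt x y (0, \<omega>) = (P * \<kappa>) *\<^sub>R \<omega>"
      by (simp add: omega1)
    have k3: "(\<eta> / (H * q)) *\<^sub>R Dt x y (0, \<phi>) = - (P * \<eta> / q) *\<^sub>R (\<kappa> *\<^sub>R I - \<sigma> *\<^sub>R E x)"
      unfolding k1 using H by simp
    have k4: "Dt x y (e, w) = P *\<^sub>R (- (\<sigma> *\<^sub>R (G *v I)) - (\<sigma> * \<eta> / q) *\<^sub>R E x + \<kappa> *\<^sub>R (\<nu> - G *v E x))"
      unfolding w1 w2 using q by (simp add: \<nu>_def scaleR_diff_right)
    show ?thesis
      unfolding T_def t k2 k3 k4 unfolding \<omega>_def by (simp add: lin algebra_simps)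
  qed
  finally have N: "Dt x y (0, N) = - T" .
  obtain Y' where Y': "(Y x has_derivative Y') (at (t x y))" "\<And>v. Y' (Dt x y (0, v)) = v"
    using Y_has_derivative[OF D Y] by blast
  note linY = has_derivative_linear[OF Y'(1)]
  have pY: "partial_deriv h (\<lambda>u. Y x u $ m) (t x y) = Y' (axis h 1) $ m" for h
    by (rule partial_deriv_eq[OF bounded_linear.has_derivative[OF bounded_linear_vec_nth Y'(1)]])
  have pt: "partial_deriv i (\<lambda>z. t z y $ h) x = Dt x y (e, 0) $ h" for h
    unfolding e_def
    by (rule partial_deriv_eq[OF bounded_linear.has_derivative[OF bounded_linear_vec_nth t_has_derivative_x[OF D]]])
  have "N_coeff a t Y x y m i = - (\<Sum>h\<in>UNIV. Y' (axis h 1) $ m * T $ h)"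
    by (simp add: N_coeff_def pY pt T_def G_def christoffel_mat_def matrix_vector_mult_def)
  also have "\<dots> = - Y' T $ m"
    by (subst linear_nth_sum[OF linY, of T]) (rule refl)
  also have "\<dots> = N $ m"
  proof -
    have "N = - Y' T" using Y'(2)[of N] linear_neg[OF linY, of T] by (simp add: N)
    then show ?thesis by simp
  qed
  also have "\<dots> = 1 / H * (1 / q) * \<eta> * F_alpha a b V x y m - 1 / H * X * \<omega> $ m - \<eta> * E x $ m
      + \<beta> * \<nu> $ m - (G *v y) $ m"
    by (simp add: N_def w_def \<phi>_def)
  \<comment> \<open>The claim contracts y with the last index of the symbol, while G acts on the
    middle one; torsion-freeness exchanges them.\<close>
  also have "(G *v y) $ m = (\<Sum>h\<in>UNIV. christoffel a x m i h * y $ h)"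
    by (simp add: G_def christoffel_mat_def matrix_vector_mult_def christoffel_sym[OF x, of m i])
  finally show ?thesis
    unfolding beta nabla_E X_def \<eta>_def \<beta>_def q_def .
qed

end

theorem proposition5p2:
  fixes U :: "(real ^ 'n::finite) set"
    and D :: "((real ^ 'n) \<times> (real ^ 'n)) set"
    and a :: "real ^ 'n \<Rightarrow> real ^ 'n ^ 'n"
    and b :: "real ^ 'n \<Rightarrow> real ^ 'n"
    and F :: "real ^ 'n \<Rightarrow> real ^ 'n \<Rightarrow> real"
    and V :: "real \<Rightarrow> real"
    and C C1 :: "real ^ 'n \<Rightarrow> real"
    and \<rho> :: "real ^ 'n \<Rightarrow> real \<Rightarrow> real"
    and t Y :: "real ^ 'n \<Rightarrow> real ^ 'n \<Rightarrow> real ^ 'n"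
    and x y :: "real ^ 'n"
    and m i :: 'n
  assumes dim: "CARD('n) \<ge> 3"
    and metric: "riemannian_metric_on U a"
    and b_smooth: "smooth_on U b"
    and c_range: "\<And>x. x \<in> U \<Longrightarrow> 0 < c_norm a b x \<and> c_norm a b x < 1"
    and c_const: "c_norm a b constant_on U"
    and dom: "conic_domain U D"
    and dom_pos: "\<And>x y. (x, y) \<in> D \<Longrightarrow> b_form b x y > 0 \<and> qt_fun a b x y > 0"
    and FS: "FS_space D a b F"
    and F_eq: "\<And>x y. (x, y) \<in> D \<Longrightarrow> F x y = b_form b x y * V (wt_fun a b x y)"
    and C_smooth: "smooth_on U C" "smooth_on U C1"
    and C_range: "\<And>x. x \<in> U \<Longrightarrow> C x > 0 \<and> C x > \<bar>C1 x\<bar>"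
    and rho_smooth: "smooth_on {(x, w_fun a b x y) | x y. (x, y) \<in> D} (\<lambda>(x, r). \<rho> x r)"
    and rho_range: "\<And>x y. (x, y) \<in> D \<Longrightarrow> 0 < \<rho> x (w_fun a b x y) \<and> \<rho> x (w_fun a b x y) < pi"
    and rho_mu: "\<And>x y. (x, y) \<in> D \<Longrightarrow>
      mu_fun C C1 x (\<rho> x (w_fun a b x y)) =
        tau_fun V (wt_fun a b x y) / (wt_fun a b x y)\<^sup>2 * (sin (\<rho> x (w_fun a b x y)))\<^sup>2"
    and rho_deriv: "\<And>x y. (x, y) \<in> D \<Longrightarrow>
      ((\<lambda>s. \<rho> x (w_of_wt a b x s)) has_real_derivative
        1 / wt_fun a b x y * sqrt (rad_tau V (wt_fun a b x y) / tau_fun V (wt_fun a b x y)) *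
        sin (\<rho> x (w_fun a b x y))) (at (wt_fun a b x y))"
    and t_eq: "\<And>x y m. (x, y) \<in> D \<Longrightarrow>
      t x y $ m =
        (i_vec a b x y $ m * sin (\<rho> x (w_fun a b x y)) +
         1 / (2 * k_breve C C1 x) *
           (1 - (k_breve C C1 x)\<^sup>2 + (1 + (k_breve C C1 x)\<^sup>2) * cos (\<rho> x (w_fun a b x y))) *
           bt_up a b x $ m) *
        (H_deg C C1 x / sqrt (mu_fun C C1 x (\<rho> x (w_fun a b x y)))) * F x y powr H_deg C C1 x"
    and conf: "conformal_automorphism D a F (H_deg C C1) t"
    and H_const: "H_deg C C1 constant_on U"
    and xy: "(x, y) \<in> D"
    and Y_inv: "local_inverse_at (t x) (Y x) y"
  shows "N_coeff a t Y x y m i =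
      1 / H_deg C C1 x * (1 / qt_fun a b x y) * y_nabla_bt a b x y i * F_alpha a b V x y m
      - 1 / H_deg C C1 x *
          (sgn (bt_form a b x (t x y)) *
           sqrt (B_fun a b V x y - (H_deg C C1 x)\<^sup>2 * (qt_fun a b x y)\<^sup>2)) *
          beta_t a b x y m i
      - y_nabla_bt a b x y i * bt_up a b x $ m
      + bt_form a b x y * nabla_vec a (bt_up a b) x i m
      - (\<Sum>h\<in>UNIV. christoffel a x m i h * y $ h)"
proof -
  have U: "x \<in> U" using dom xy by (auto simp: conic_domain_def)
  obtain c where c: "\<And>z. z \<in> U \<Longrightarrow> c_norm a b z = c"
    using c_const unfolding constant_on_def by blast
  obtain H where H: "\<And>z. z \<in> U \<Longrightarrow> H_deg C C1 z = H"
    using H_const unfolding constant_on_def by blast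
  interpret conformal_FS_space U a b c D F V C C1 \<rho> t H
  proof
    show "finsler_metric_on D F" using FS by (simp add: FS_space_def)
    show "0 < c" "c < 1" using c_range[OF U] c[OF U] by auto
  qed (fact metric b_smooth c dom dom_pos F_eq C_range rho_range rho_mu rho_deriv t_eq conf H)+
  show ?thesis
    unfolding H[OF U] by (rule N_coeff_formula[where Y = Y, OF xy Y_inv])
qed

end
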